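(* Every closed exact lcs surface $(M,\lambda,\alpha)$ (i.e. $M$ is a closed manifold of dimension 2) satisfying the Reeb condition $\lambda(X_\alpha)>0$ has a Reeb 1-curve.
   Context: An exact lcs manifold is $(M,\lambda,\alpha)$ with $\lambda,\alpha$ 1-forms on $M$, $\alpha$ closed and $\omega=d_\alpha\lambda:=d\lambda-\alpha\wedge\lambda$ non-degenerate. Vector fields $X_\lambda,X_\alpha$ are given by $\omega(X_\lambda,\cdot)=\lambda$, $\omega(X_\alpha,\cdot)=\alpha$, and $\mathcal{D}(p)=\operatorname{span}(X_\alpha(p),X_\lambda(p))$. The Reeb condition is that $\lambda(X_\alpha)>0$ everywhere. A Reeb 1-curve in $(M,\lambda,\alpha)$ is a smooth map $o:S^1\to M$ such that for all $t\in S^1$: $\lambda(o'(t))>0$ and $o'(t)\in\mathcal{D}$. *)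

theory Defs
  imports "HOL-Analysis.Analysis"
begin

section \<open>Smooth maps between open subsets of normed spaces\<close>

(* Intended for open S only. On a finite-dimensional domain, continuity of all iterated
   directional derivatives is continuity of the iterated derivatives. *)
fun Ck_on :: "nat \<Rightarrow> 'a::real_normed_vector set \<Rightarrow> ('a \<Rightarrow> 'b::real_normed_vector) \<Rightarrow> bool" where
  "Ck_on 0 S f \<longleftrightarrow> continuous_on S f"
| "Ck_on (Suc k) S f \<longleftrightarrow>
     (\<forall>x\<in>S. f differentiable (at x)) \<and>
     (\<forall>v. Ck_on k S (\<lambda>x. frechet_derivative f (at x) v))"

definition smooth_on :: "'a::real_normed_vector set \<Rightarrow> ('a \<Rightarrow> 'b::real_normed_vector) \<Rightarrow> bool" where
  "smooth_on S f \<longleftrightarrow> (\<forall>k. Ck_on k S f)"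

section \<open>Smooth manifolds without boundary, modelled on a Euclidean space\<close>

(* A chart is a pair (domain, coordinate map); values of the map off the domain are irrelevant. *)
type_synonym ('a, 'e) chart = "'a set \<times> ('a \<Rightarrow> 'e)"

definition is_chart :: "'a topology \<Rightarrow> ('a, 'e::euclidean_space) chart \<Rightarrow> bool" where
  "is_chart M c \<longleftrightarrow>
     openin M (fst c) \<and> open (snd c ` fst c) \<and>
     homeomorphic_map (subtopology M (fst c)) (top_of_set (snd c ` fst c)) (snd c)"

definition chart_inv :: "('a, 'e) chart \<Rightarrow> 'e \<Rightarrow> 'a" where
  "chart_inv c = inv_into (fst c) (snd c)"

definition transition :: "('a, 'e) chart \<Rightarrow> ('a, 'e) chart \<Rightarrow> 'e \<Rightarrow> 'e" where
  "transition c d = snd d \<circ> chart_inv c"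

(* The atlas need not be maximal: any atlas determines the smooth structure. *)
definition smooth_manifold :: "'a topology \<Rightarrow> ('a, 'e::euclidean_space) chart set \<Rightarrow> bool" where
  "smooth_manifold M A \<longleftrightarrow>
     Hausdorff_space M \<and> second_countable M \<and>
     (\<forall>c\<in>A. is_chart M c) \<and>
     topspace M = (\<Union>c\<in>A. fst c) \<and>
     (\<forall>c\<in>A. \<forall>d\<in>A. smooth_on (snd c ` (fst c \<inter> fst d)) (transition c d))"

section \<open>Tangent vectors\<close>

(* A tangent vector at p is the family of its coordinate vectors in all charts around p, which
   transform by the derivatives of the transition maps. The components for all other pairs are
   set to 0, so that equal tangent vectors are equal as functions; the linear structure is
   pointwise. *)
type_synonym ('a, 'e) tvec = "('a, 'e) chart \<Rightarrow> 'e"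

definition tangent_space ::
    "('a, 'e::euclidean_space) chart set \<Rightarrow> 'a \<Rightarrow> ('a, 'e) tvec set" where
  "tangent_space A p =
     {v. (\<forall>c\<in>A. \<forall>d\<in>A. p \<in> fst c \<and> p \<in> fst d \<longrightarrow>
            v d = frechet_derivative (transition c d) (at (snd c p)) (v c)) \<and>
         (\<forall>c. \<not> (c \<in> A \<and> p \<in> fst c) \<longrightarrow> v c = 0)}"

(* The tangent vector at p whose coordinate vector in the chart c is e. *)
definition coord_vec ::
    "('a, 'e::euclidean_space) chart set \<Rightarrow> ('a, 'e) chart \<Rightarrow> 'e \<Rightarrow> 'a \<Rightarrow> ('a, 'e) tvec" where
  "coord_vec A c e p =
     (\<lambda>d. if d \<in> A \<and> p \<in> fst d
          then frechet_derivative (transition c d) (at (snd c p)) e else 0)"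

section \<open>Differential forms\<close>

type_synonym ('a, 'e) form1 = "'a \<Rightarrow> ('a, 'e) tvec \<Rightarrow> real"
type_synonym ('a, 'e) form2 = "'a \<Rightarrow> ('a, 'e) tvec \<Rightarrow> ('a, 'e) tvec \<Rightarrow> real"

(* Coordinate expression on the open set snd c ` fst c, evaluated on a constant vector e. *)
definition local_form ::
    "('a, 'e::euclidean_space) chart set \<Rightarrow> ('a, 'e) chart \<Rightarrow> ('a, 'e) form1 \<Rightarrow> 'e \<Rightarrow> 'e \<Rightarrow> real"
  where
  "local_form A c \<beta> e x = \<beta> (chart_inv c x) (coord_vec A c e (chart_inv c x))"

definition one_form ::
    "'a topology \<Rightarrow> ('a, 'e::euclidean_space) chart set \<Rightarrow> ('a, 'e) form1 \<Rightarrow> bool" where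
  "one_form M A \<beta> \<longleftrightarrow>
     (\<forall>p\<in>topspace M. \<forall>u\<in>tangent_space A p. \<forall>v\<in>tangent_space A p. \<forall>a b.
        \<beta> p (\<lambda>c. a *\<^sub>R u c + b *\<^sub>R v c) = a * \<beta> p u + b * \<beta> p v) \<and>
     (\<forall>c\<in>A. \<forall>e. smooth_on (snd c ` fst c) (local_form A c \<beta> e))"

(* The coordinate formula for d\<beta>, extending u and v to vector fields that are constant in the
   chart. The value does not depend on the chart around p, so an arbitrary one is chosen.
   Normalisation: d\<beta>(U,V) = U(\<beta>(V)) - V(\<beta>(U)) - \<beta>([U,V]). *)
definition ext_deriv ::
    "('a, 'e::euclidean_space) chart set \<Rightarrow> ('a, 'e) form1 \<Rightarrow> ('a, 'e) form2" where
  "ext_deriv A \<beta> p u v =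
     (let c = (SOME c. c \<in> A \<and> p \<in> fst c) in
        frechet_derivative (local_form A c \<beta> (v c)) (at (snd c p)) (u c)
      - frechet_derivative (local_form A c \<beta> (u c)) (at (snd c p)) (v c))"

definition closed_form ::
    "'a topology \<Rightarrow> ('a, 'e::euclidean_space) chart set \<Rightarrow> ('a, 'e) form1 \<Rightarrow> bool" where
  "closed_form M A \<beta> \<longleftrightarrow>
     (\<forall>p\<in>topspace M. \<forall>u\<in>tangent_space A p. \<forall>v\<in>tangent_space A p. ext_deriv A \<beta> p u v = 0)"

definition wedge :: "('a, 'e) form1 \<Rightarrow> ('a, 'e) form1 \<Rightarrow> ('a, 'e) form2" where
  "wedge \<beta> \<eta> p u v = \<beta> p u * \<eta> p v - \<beta> p v * \<eta> p u"

definition nondegenerate ::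
    "'a topology \<Rightarrow> ('a, 'e::euclidean_space) chart set \<Rightarrow> ('a, 'e) form2 \<Rightarrow> bool" where
  "nondegenerate M A w \<longleftrightarrow>
     (\<forall>p\<in>topspace M. \<forall>u\<in>tangent_space A p.
        (\<forall>v\<in>tangent_space A p. w p u v = 0) \<longrightarrow> u = (\<lambda>c. 0))"

section \<open>Exact lcs manifolds and Reeb 1-curves\<close>

(* The Lichnerowicz differential of lam with respect to \<alpha>. *)
definition lcs_form ::
    "('a, 'e::euclidean_space) chart set \<Rightarrow> ('a, 'e) form1 \<Rightarrow> ('a, 'e) form1 \<Rightarrow> ('a, 'e) form2"
  where
  "lcs_form A lam \<alpha> p u v = ext_deriv A lam p u v - wedge \<alpha> lam p u v"

definition exact_lcs_manifold ::
    "'a topology \<Rightarrow> ('a, 'e::euclidean_space) chart set \<Rightarrow>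
     ('a, 'e) form1 \<Rightarrow> ('a, 'e) form1 \<Rightarrow> bool" where
  "exact_lcs_manifold M A lam \<alpha> \<longleftrightarrow>
     smooth_manifold M A \<and> one_form M A lam \<and> one_form M A \<alpha> \<and>
     closed_form M A \<alpha> \<and> nondegenerate M A (lcs_form A lam \<alpha>)"

(* The vector field X with w(X, _) = \<beta>; unique where w is non-degenerate. *)
definition dual_field ::
    "('a, 'e::euclidean_space) chart set \<Rightarrow> ('a, 'e) form2 \<Rightarrow> ('a, 'e) form1 \<Rightarrow>
     'a \<Rightarrow> ('a, 'e) tvec" where
  "dual_field A w \<beta> p =
     (THE u. u \<in> tangent_space A p \<and> (\<forall>v\<in>tangent_space A p. w p u v = \<beta> p v))"

definition X_lambda ::
    "('a, 'e::euclidean_space) chart set \<Rightarrow> ('a, 'e) form1 \<Rightarrow> ('a, 'e) form1 \<Rightarrow>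
     'a \<Rightarrow> ('a, 'e) tvec" where
  "X_lambda A lam \<alpha> = dual_field A (lcs_form A lam \<alpha>) lam"

definition X_alpha ::
    "('a, 'e::euclidean_space) chart set \<Rightarrow> ('a, 'e) form1 \<Rightarrow> ('a, 'e) form1 \<Rightarrow>
     'a \<Rightarrow> ('a, 'e) tvec" where
  "X_alpha A lam \<alpha> = dual_field A (lcs_form A lam \<alpha>) \<alpha>"

definition lcs_distribution ::
    "('a, 'e::euclidean_space) chart set \<Rightarrow> ('a, 'e) form1 \<Rightarrow> ('a, 'e) form1 \<Rightarrow>
     'a \<Rightarrow> ('a, 'e) tvec set" where
  "lcs_distribution A lam \<alpha> p =
     {v. \<exists>a b. v = (\<lambda>c. a *\<^sub>R X_alpha A lam \<alpha> p c + b *\<^sub>R X_lambda A lam \<alpha> p c)}"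

definition reeb_condition ::
    "'a topology \<Rightarrow> ('a, 'e::euclidean_space) chart set \<Rightarrow>
     ('a, 'e) form1 \<Rightarrow> ('a, 'e) form1 \<Rightarrow> bool" where
  "reeb_condition M A lam \<alpha> \<longleftrightarrow> (\<forall>p\<in>topspace M. lam p (X_alpha A lam \<alpha> p) > 0)"

(* With the circle taken to be R/Z, smooth maps from it to M are the 1-periodic smooth maps from
   R to M. *)
definition smooth_loop ::
    "'a topology \<Rightarrow> ('a, 'e::euclidean_space) chart set \<Rightarrow> (real \<Rightarrow> 'a) \<Rightarrow> bool" where
  "smooth_loop M A \<gamma> \<longleftrightarrow>
     (\<forall>t. \<gamma> (t + 1) = \<gamma> t) \<and>
     continuous_map euclideanreal M \<gamma> \<and>
     (\<forall>c\<in>A. smooth_on {t. \<gamma> t \<in> fst c} (snd c \<circ> \<gamma>))"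

definition velocity ::
    "('a, 'e::euclidean_space) chart set \<Rightarrow> (real \<Rightarrow> 'a) \<Rightarrow> real \<Rightarrow> ('a, 'e) tvec" where
  "velocity A \<gamma> t =
     (\<lambda>c. if c \<in> A \<and> \<gamma> t \<in> fst c then vector_derivative (snd c \<circ> \<gamma>) (at t) else 0)"

definition reeb_1_curve ::
    "'a topology \<Rightarrow> ('a, 'e::euclidean_space) chart set \<Rightarrow>
     ('a, 'e) form1 \<Rightarrow> ('a, 'e) form1 \<Rightarrow> (real \<Rightarrow> 'a) \<Rightarrow> bool" where
  "reeb_1_curve M A lam \<alpha> \<gamma> \<longleftrightarrow>
     smooth_loop M A \<gamma> \<and>
     (\<forall>t. lam (\<gamma> t) (velocity A \<gamma> t) > 0 \<and>
          velocity A \<gamma> t \<in> lcs_distribution A lam \<alpha> (\<gamma> t))"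

end

theory Submission
  imports Defs
begin

text \<open>
  The argument is the one which shows that a compact spacetime contains a closed timelike curve.
  Call a curve positive if \<open>\<lambda>\<close> is positive on its velocity, and write \<open>p \<rightarrow> q\<close> if a positive curve leads
  from \<open>p\<close> to \<open>q\<close>. Everything rests on positivity being an open and convex condition on velocities:

  \<^item> a concatenation of positive curves can be smoothed at the corner without losing positivity
    (\<open>positive_corner\<close>), so \<open>\<rightarrow>\<close> is transitive (\<open>positively_connected_trans\<close>), and
    \<open>p \<rightarrow> p\<close> yields a smooth positive loop (\<open>positively_connected_self_imp_loop\<close>);

  \<^item> starting from a point slightly behind \<open>q\<close>, straight segments in a chart reach a whole
    neighbourhood of \<open>q\<close> (\<open>positive_segments\<close>).

  By compactness finitely many of these neighbourhoods cover the manifold. Each of the finitely many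
  starting points lies in one of them, hence has a predecessor among the starting points, and a
  transitive relation on a finite nonempty set in which every element has a predecessor is not
  irreflexive. This gives \<open>p \<rightarrow> p\<close> for some \<open>p\<close> (\<open>exists_positive_loop\<close>).

  The Reeb condition enters twice. It makes \<open>\<lambda>\<close> positive on some tangent vector at every point, and it
  forces \<open>X\<^sub>\<alpha>\<close> and \<open>X\<^sub>\<lambda>\<close> to be linearly independent, so that on a surface the distribution they span
  is the whole tangent plane (\<open>lcs_distribution_surface\<close>) and every positive loop is a Reeb 1-curve.
\<close>

section \<open>Calculus of smooth maps\<close>

lemma frechet_derivative_cong_open:
  assumes "open S" "x \<in> S" "\<And>y. y \<in> S \<Longrightarrow> f y = g y"
  shows "frechet_derivative f (at x) = frechet_derivative g (at x)"
proof -
  have "(f has_derivative D) (at x) \<longleftrightarrow> (g has_derivative D) (at x)" for D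
    using assms has_derivative_transform_within_open[of f D x UNIV S g]
      has_derivative_transform_within_open[of g D x UNIV S f] by auto
  then show ?thesis
    by (simp add: frechet_derivative_def)
qed

lemma differentiable_cong_open:
  assumes "open S" "x \<in> S" "\<And>y. y \<in> S \<Longrightarrow> f y = g y"
  shows "f differentiable (at x) \<longleftrightarrow> g differentiable (at x)"
  using assms has_derivative_transform_within_open[of f _ x UNIV S g]
      has_derivative_transform_within_open[of g _ x UNIV S f]
  unfolding differentiable_def by auto

lemma Ck_on_cong_imp:
  assumes "open S" "\<And>x. x \<in> S \<Longrightarrow> f x = g x" "Ck_on k S f"
  shows "Ck_on k S g"
  using assms(2,3)
proof (induction k arbitrary: f g)
  case 0
  then show ?case by (metis Ck_on.simps(1) continuous_on_cong)
next
  case (Suc k)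
  have "frechet_derivative f (at x) v = frechet_derivative g (at x) v" if "x \<in> S" for x v
    using frechet_derivative_cong_open[OF assms(1) that Suc.prems(1)] by simp
  moreover have "g differentiable (at x)" if "x \<in> S" for x
    using Suc.prems that differentiable_cong_open[OF assms(1) that Suc.prems(1)] by auto
  moreover have "Ck_on k S (\<lambda>x. frechet_derivative g (at x) v)" for v
    by (rule Suc.IH[of "\<lambda>x. frechet_derivative f (at x) v"])
      (use Suc.prems(2) calculation(1) in simp_all)
  ultimately show ?case by simp
qed

lemma Ck_on_Suc_derivI:
  assumes "open S" "\<And>x. x \<in> S \<Longrightarrow> (f has_derivative f' x) (at x)"
    and "\<And>v. Ck_on k S (\<lambda>x. f' x v)"
  shows "Ck_on (Suc k) S f"
proof -
  have "frechet_derivative f (at x) = f' x" if "x \<in> S" for x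
    using assms(2)[OF that] frechet_derivative_at by metis
  then have "Ck_on k S (\<lambda>x. frechet_derivative f (at x) v)" for v
    by (intro Ck_on_cong_imp[OF assms(1) _ assms(3)[of v]]) simp
  moreover have "f differentiable (at x)" if "x \<in> S" for x
    using assms(2)[OF that] by (rule differentiableI)
  ultimately show ?thesis by simp
qed

lemma Ck_on_SucD: "Ck_on (Suc k) S f \<Longrightarrow> Ck_on k S f"
proof (induction k arbitrary: f)
  case 0
  then show ?case
    by (auto intro!: continuous_at_imp_continuous_on differentiable_imp_continuous_within)
next
  case (Suc k)
  then show ?case by (metis Ck_on.simps(2))
qed

lemma Ck_on_subset: "Ck_on k S f \<Longrightarrow> T \<subseteq> S \<Longrightarrow> Ck_on k T f"
  by (induction k arbitrary: f) (auto intro: continuous_on_subset)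

lemma Ck_on_local:
  assumes "\<And>x. x \<in> S \<Longrightarrow> \<exists>U. open U \<and> x \<in> U \<and> Ck_on k U f"
  shows "Ck_on k S f"
  using assms
proof (induction k arbitrary: f)
  case 0
  then have "isCont f x" if "x \<in> S" for x
    using that continuous_on_eq_continuous_at by fastforce
  then show ?case
    by (simp add: continuous_at_imp_continuous_on)
next
  case (Suc k)
  then show ?case by (simp, meson)
qed

lemma smooth_on_cong_imp:
  "open S \<Longrightarrow> (\<And>x. x \<in> S \<Longrightarrow> f x = g x) \<Longrightarrow> smooth_on S f \<Longrightarrow> smooth_on S g"
  unfolding smooth_on_def using Ck_on_cong_imp by blast

lemma smooth_on_subset: "smooth_on S f \<Longrightarrow> T \<subseteq> S \<Longrightarrow> smooth_on T f"
  unfolding smooth_on_def using Ck_on_subset by blast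

lemma smooth_on_local:
  assumes "\<And>x. x \<in> S \<Longrightarrow> \<exists>U. open U \<and> x \<in> U \<and> smooth_on U f"
  shows "smooth_on S f"
  unfolding smooth_on_def using assms by (metis Ck_on_local smooth_on_def)

lemma smooth_on_imp_continuous_on: "smooth_on S f \<Longrightarrow> continuous_on S f"
  unfolding smooth_on_def by (metis Ck_on.simps(1))

lemma smooth_on_imp_differentiable: "smooth_on S f \<Longrightarrow> x \<in> S \<Longrightarrow> f differentiable (at x)"
  unfolding smooth_on_def by (metis Ck_on.simps(2))

lemma smooth_on_frechet_derivative:
  "smooth_on S f \<Longrightarrow> smooth_on S (\<lambda>x. frechet_derivative f (at x) v)"
  unfolding smooth_on_def by (metis Ck_on.simps(2))

lemma Ck_on_const: "Ck_on k S (\<lambda>x. c)"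
proof (induction k arbitrary: c)
  case (Suc k)
  then show ?case by simp
qed simp

lemma Ck_on_add:
  assumes "open S" "Ck_on k S f" "Ck_on k S g"
  shows "Ck_on k S (\<lambda>x. f x + g x)"
  using assms(2,3)
proof (induction k arbitrary: f g)
  case 0
  then show ?case by (auto intro: continuous_intros)
next
  case (Suc k)
  show ?case
    by (rule Ck_on_Suc_derivI[OF assms(1),
        where f' = "\<lambda>x v. frechet_derivative f (at x) v + frechet_derivative g (at x) v"])
      (use Suc in \<open>auto intro!: has_derivative_add simp: frechet_derivative_works[symmetric]\<close>)
qed

lemma Ck_on_sum:
  assumes "open S" "\<And>i. i \<in> I \<Longrightarrow> Ck_on k S (f i)"
  shows "Ck_on k S (\<lambda>x. \<Sum>i\<in>I. f i x)"
  using assms(2)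
  by (induction I rule: infinite_finite_induct) (auto intro: Ck_on_add[OF assms(1)] Ck_on_const)

lemma (in bounded_bilinear) Ck_on_prod:
  assumes "open S" "Ck_on k S f" "Ck_on k S g"
  shows "Ck_on k S (\<lambda>x. prod (f x) (g x))"
  using assms(2,3)
proof (induction k arbitrary: f g)
  case 0
  then show ?case by (auto intro: continuous_on)
next
  case (Suc k)
  show ?case
  proof (rule Ck_on_Suc_derivI[OF assms(1)])
    show "((\<lambda>x. prod (f x) (g x)) has_derivative
       (\<lambda>v. prod (f x) (frechet_derivative g (at x) v) +
            prod (frechet_derivative f (at x) v) (g x))) (at x)"
      if "x \<in> S" for x
      using Suc.prems that by (intro FDERIV) (simp_all add: frechet_derivative_works[symmetric])
    show "Ck_on k S (\<lambda>x. prod (f x) (frechet_derivative g (at x) v) +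
            prod (frechet_derivative f (at x) v) (g x))" for v
      using Suc.prems Suc.prems[THEN Ck_on_SucD] by (auto intro!: Ck_on_add[OF assms(1)] Suc.IH)
  qed
qed

lemma Ck_on_bounded_linear:
  assumes "open S" "bounded_linear h" "Ck_on k S f"
  shows "Ck_on k S (\<lambda>x. h (f x))"
  using assms(3)
proof (induction k arbitrary: f)
  case 0
  then show ?case
    using assms(2) by (auto intro: bounded_linear.continuous_on)
next
  case (Suc k)
  show ?case
  proof (rule Ck_on_Suc_derivI[OF assms(1)])
    show "((\<lambda>x. h (f x)) has_derivative (\<lambda>v. h (frechet_derivative f (at x) v))) (at x)"
      if "x \<in> S" for x
      using Suc.prems that
      by (intro bounded_linear.has_derivative[OF assms(2)])
        (simp add: frechet_derivative_works[symmetric])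
    show "Ck_on k S (\<lambda>x. h (frechet_derivative f (at x) v))" for v
      using Suc.prems by (intro Suc.IH) simp
  qed
qed

lemma linear_euclidean_expansion:
  assumes "linear (h :: 'e::euclidean_space \<Rightarrow> _)"
  shows "h e = (\<Sum>b\<in>Basis. (e \<bullet> b) *\<^sub>R h b)"
proof -
  have "h e = h (\<Sum>b\<in>Basis. (e \<bullet> b) *\<^sub>R b)"
    by (simp add: euclidean_representation)
  then show ?thesis
    by (simp add: linear_sum[OF assms] linear_cmul[OF assms] del: euclidean_representation)
qed

text \<open>The chain rule expresses the derivative of the composite through
  \<open>Dg (f x)\<close> applied to basis vectors, that is, through composites of \<open>f\<close> with maps of lower
  regularity, so that the induction closes.\<close>

lemma Ck_on_compose:
  fixes f :: "'a::real_normed_vector \<Rightarrow> 'e::euclidean_space"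
  assumes "open S" "open T" "f ` S \<subseteq> T" "Ck_on k S f" "Ck_on k T g"
  shows "Ck_on k S (\<lambda>x. g (f x))"
  using assms(4,5)
proof (induction k arbitrary: g)
  case 0
  then show ?case
    using assms(3) continuous_on_compose2 by auto
next
  case (Suc k)
  let ?G = "\<lambda>x v. \<Sum>b\<in>Basis. (frechet_derivative f (at x) v \<bullet> b) *\<^sub>R
    frechet_derivative g (at (f x)) b"
  show ?case
  proof (rule Ck_on_Suc_derivI[OF assms(1)])
    fix x assume x: "x \<in> S"
    have f: "(f has_derivative frechet_derivative f (at x)) (at x)"
      using Suc.prems x by (simp add: frechet_derivative_works[symmetric])
    have g: "(g has_derivative frechet_derivative g (at (f x))) (at (f x))"
      using Suc.prems x assms(3) by (auto simp: frechet_derivative_works[symmetric])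
    have "?G x = (\<lambda>v. frechet_derivative g (at (f x)) (frechet_derivative f (at x) v))"
      by (intro ext linear_euclidean_expansion[OF has_derivative_linear[OF g], symmetric])
    then show "((\<lambda>x. g (f x)) has_derivative ?G x) (at x)"
      using has_derivative_compose[OF f g] by simp
  next
    fix v
    show "Ck_on k S (\<lambda>x. ?G x v)"
      using Suc.prems Ck_on_SucD[OF Suc.prems(1)]
      by (intro Ck_on_sum[OF assms(1)] bounded_bilinear.Ck_on_prod[OF bounded_bilinear_scaleR assms(1)]
          Ck_on_bounded_linear[OF assms(1) bounded_linear_inner_left] Suc.IH) auto
  qed
qed

lemma smooth_on_compose:
  fixes f :: "'a::real_normed_vector \<Rightarrow> 'e::euclidean_space"
  assumes "open S" "open T" "f ` S \<subseteq> T" "smooth_on S f" "smooth_on T g"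
  shows "smooth_on S (\<lambda>x. g (f x))"
  using assms Ck_on_compose unfolding smooth_on_def by blast

lemma smooth_on_const: "smooth_on S (\<lambda>x. c)"
  by (simp add: smooth_on_def Ck_on_const)

lemma smooth_on_add: "open S \<Longrightarrow> smooth_on S f \<Longrightarrow> smooth_on S g \<Longrightarrow> smooth_on S (\<lambda>x. f x + g x)"
  by (simp add: smooth_on_def Ck_on_add)

lemma smooth_on_mult:
  fixes f g :: "_ \<Rightarrow> 'b::real_normed_algebra"
  shows "open S \<Longrightarrow> smooth_on S f \<Longrightarrow> smooth_on S g \<Longrightarrow> smooth_on S (\<lambda>x. f x * g x)"
  by (simp add: smooth_on_def bounded_bilinear.Ck_on_prod[OF bounded_bilinear_mult])

lemma smooth_on_bounded_linear: "open S \<Longrightarrow> bounded_linear h \<Longrightarrow> smooth_on S h"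
proof -
  assume S: "open S" and h: "bounded_linear h"
  have "Ck_on k S h" for k
  proof (cases k)
    case 0
    then show ?thesis using h linear_continuous_on by auto
  next
    case (Suc m)
    show ?thesis
      unfolding Suc using h
      by (intro Ck_on_Suc_derivI[OF S, where f' = "\<lambda>x. h"])
        (auto intro: bounded_linear_imp_has_derivative Ck_on_const)
  qed
  then show ?thesis by (simp add: smooth_on_def)
qed

lemma smooth_on_affine:
  assumes "open S"
  shows "smooth_on S (\<lambda>t::real. a * t + b)" "smooth_on S (\<lambda>t::real. x + t *\<^sub>R v)"
  by (intro smooth_on_add assms smooth_on_const smooth_on_bounded_linear
      bounded_linear_mult_right bounded_linear_scaleR_left)+

section \<open>A smooth ramp\<close>

lemma smooth_on_inverse: "smooth_on {0<..} (inverse :: real \<Rightarrow> real)"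
proof -
  have "Ck_on k {0<..} (inverse :: real \<Rightarrow> real)" for k
  proof (induction k)
    case 0
    then show ?case by (auto intro!: continuous_intros)
  next
    case (Suc k)
    show ?case
    proof (rule Ck_on_Suc_derivI)
      show "(inverse has_derivative (\<lambda>v. (inverse x * inverse x) * (- v))) (at x)"
        if "x \<in> {0<..}" for x :: real
        using that by (auto intro!: derivative_eq_intros)
      show "Ck_on k {0<..} (\<lambda>x. (inverse x * inverse x) * (- v :: real))" for v
        by (intro bounded_bilinear.Ck_on_prod[OF bounded_bilinear_mult] Suc Ck_on_const) auto
    qed auto
  qed
  then show ?thesis by (simp add: smooth_on_def)
qed

text \<open>The function \<open>(1/s)^n exp (-1/s)\<close>, extended by 0 to the left half-line. Only \<open>n = 0\<close> enters the
  step function below; the whole family is closed under differentiation up to linear combinations,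
  and this makes smoothness at 0 an induction.\<close>

definition flat_fun :: "nat \<Rightarrow> real \<Rightarrow> real" where
  "flat_fun n s = (if s \<le> 0 then 0 else inverse s ^ n * exp (- inverse s))"

lemma flat_fun_tendsto_0: "(flat_fun n \<longlongrightarrow> 0) (at 0)"
proof (rule filterlim_split_at)
  show "(flat_fun n \<longlongrightarrow> 0) (at_left 0)"
    by (rule tendsto_eventually) (auto simp: flat_fun_def eventually_at_filter)
  have "((\<lambda>s. inverse s ^ n / exp (inverse s)) \<longlongrightarrow> (0::real)) (at_right 0)"
    by (rule filterlim_compose[OF tendsto_power_div_exp_0 filterlim_inverse_at_top_right])
  moreover have "\<forall>\<^sub>F s in at_right 0. inverse s ^ n / exp (inverse s) = flat_fun n s"
    by (auto simp: flat_fun_def eventually_at_filter exp_minus divide_inverse)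
  ultimately show "(flat_fun n \<longlongrightarrow> 0) (at_right 0)"
    by (rule Lim_transform_eventually)
qed

lemma flat_fun_derivative:
  "(flat_fun n has_real_derivative (flat_fun (n + 2) s - real n * flat_fun (n + 1) s)) (at s)"
proof -
  consider "s < 0" | "s = 0" | "s > 0" by linarith
  then show ?thesis
  proof cases
    case 1
    have "((\<lambda>_. 0) has_real_derivative 0) (at s)" by simp
    then have "(flat_fun n has_real_derivative 0) (at s)"
      by (rule has_field_derivative_transform_within_open[where S="{..<0}"])
        (use 1 in \<open>auto simp: flat_fun_def\<close>)
    then show ?thesis using 1 by (simp add: flat_fun_def)
  next
    case 2
    have "((\<lambda>h. (flat_fun n (0 + h) - flat_fun n 0) / h) \<longlongrightarrow> 0) (at 0)"
      by (rule Lim_transform_eventually[OF flat_fun_tendsto_0[of "Suc n"]])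
        (auto simp: flat_fun_def eventually_at_filter divide_inverse)
    then show ?thesis
      using 2 by (simp add: DERIV_def flat_fun_def)
  next
    case 3
    let ?D = "inverse s ^ n * (exp (- inverse s) * (inverse s ^ 2)) +
      real n * inverse s ^ (n - 1) * (- (inverse s ^ 2)) * exp (- inverse s)"
    have "((\<lambda>s. inverse s ^ n * exp (- inverse s)) has_real_derivative ?D) (at s)"
      using 3 by (auto intro!: derivative_eq_intros simp: power2_eq_square algebra_simps)
    also have "?D = flat_fun (n + 2) s - real n * flat_fun (n + 1) s"
      using 3 by (cases n) (auto simp: flat_fun_def power_add power2_eq_square algebra_simps)
    finally show ?thesis
      by (rule has_field_derivative_transform_within_open[where S="{0<..}"])
        (use 3 in \<open>auto simp: flat_fun_def\<close>)
  qed
qed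

lemma smooth_on_flat_fun: "smooth_on UNIV (flat_fun n)"
proof -
  have "Ck_on k UNIV (flat_fun n)" for k
  proof (induction k arbitrary: n)
    case 0
    have "isCont (flat_fun n) s" for s
      using flat_fun_derivative DERIV_isCont by blast
    then show ?case by (simp add: continuous_on_eq_continuous_at)
  next
    case (Suc k)
    show ?case
    proof (rule Ck_on_Suc_derivI)
      show "(flat_fun n has_derivative
          (\<lambda>v. (flat_fun (n + 2) s + (- real n) * flat_fun (n + 1) s) * v)) (at s)" for s
        using flat_fun_derivative[of n s] by (simp add: has_field_derivative_def)
      show "Ck_on k UNIV (\<lambda>s. (flat_fun (n + 2) s + (- real n) * flat_fun (n + 1) s) * v)" for v
        by (intro bounded_bilinear.Ck_on_prod[OF bounded_bilinear_mult] Ck_on_add Ck_on_const Suc)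
          auto
    qed auto
  qed
  then show ?thesis by (simp add: smooth_on_def)
qed

lemma flat_fun_nonneg: "flat_fun n s \<ge> 0"
  by (simp add: flat_fun_def)

lemma flat_fun_sum_pos: "flat_fun 0 s + flat_fun 0 (1 - s) > 0"
  by (auto simp: flat_fun_def add_pos_pos)

definition smooth_step :: "real \<Rightarrow> real" where
  "smooth_step s = flat_fun 0 s * inverse (flat_fun 0 s + flat_fun 0 (1 - s))"

lemma smooth_on_smooth_step: "smooth_on UNIV smooth_step"
proof -
  have f1: "smooth_on UNIV (\<lambda>s. flat_fun 0 (1 - s))"
    using smooth_on_compose[OF _ _ _ smooth_on_affine(1)[of UNIV "-1" 1] smooth_on_flat_fun] by simp
  show ?thesis
    unfolding smooth_step_def
    by (intro smooth_on_mult smooth_on_flat_fun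
        smooth_on_compose[OF _ _ _ smooth_on_add[OF _ smooth_on_flat_fun f1] smooth_on_inverse])
      (use flat_fun_sum_pos in auto)
qed

lemma smooth_step_derivative_nonneg:
  obtains D where "(smooth_step has_real_derivative D) (at s)" "D \<ge> 0"
proof -
  let ?f = "flat_fun 0" and ?g = "flat_fun 2"
  have f: "(?f has_real_derivative ?g s) (at s)" for s
    using flat_fun_derivative[of 0 s] by (simp add: numeral_2_eq_2)
  have "((\<lambda>s. 1 - s) has_real_derivative - 1) (at s)"
    by (auto intro!: derivative_eq_intros)
  then have f1: "((\<lambda>s. ?f (1 - s)) has_real_derivative - ?g (1 - s)) (at s)"
    using DERIV_chain2[OF f] by fastforce
  let ?D = "(?g s * (?f s + ?f (1 - s)) - ?f s * (?g s - ?g (1 - s))) 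
    / ((?f s + ?f (1 - s)) * (?f s + ?f (1 - s)))"
  have "(smooth_step has_real_derivative ?D) (at s)"
    unfolding smooth_step_def divide_inverse[symmetric]
    using flat_fun_sum_pos[of s] DERIV_divide[OF f DERIV_add[OF f f1]] by simp
  moreover have "?g s * (?f s + ?f (1 - s)) - ?f s * (?g s - ?g (1 - s))
      = ?g s * ?f (1 - s) + ?f s * ?g (1 - s)" by (simp add: algebra_simps)
  then have "?D \<ge> 0" by (simp add: flat_fun_nonneg)
  ultimately show ?thesis using that by blast
qed

text \<open>The ramp will reparametrize a curve so that it starts from rest: it waits at time 0, speeds up
  on \<open>(0, \<eta>)\<close> without stopping, and from \<open>\<eta>\<close> on it is the original clock, so that reparametrized
  curves fit together with the original ones.\<close>

lemma smooth_ramp_exists: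
  assumes "\<eta> > (0::real)"
  obtains k k' :: "real \<Rightarrow> real"
  where "smooth_on UNIV k" "\<And>s. (k has_real_derivative k' s) (at s)"
    "\<And>s. s \<le> 0 \<Longrightarrow> k s = 0" "\<And>s. s \<ge> \<eta> \<Longrightarrow> k s = s" "\<And>s. 0 \<le> k s \<and> k s \<le> \<bar>s\<bar>"
    "\<And>s. s > 0 \<Longrightarrow> k' s > 0" "\<And>s. k' s \<ge> 0"
proof -
  define k where "k = (\<lambda>s. s * smooth_step (inverse \<eta> * s + 0))"
  have 01: "0 \<le> smooth_step s \<and> smooth_step s \<le> 1" for s
    unfolding smooth_step_def divide_inverse[symmetric]
    using flat_fun_sum_pos[of s] flat_fun_nonneg[of 0 s] flat_fun_nonneg[of 0 "1 - s"] by simp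
  have z: "smooth_step s = 0" if "s \<le> 0" for s
    using that by (simp add: smooth_step_def flat_fun_def)
  have one: "smooth_step s = 1" if "s \<ge> 1" for s
    using that by (simp add: smooth_step_def flat_fun_def)
  have p: "smooth_step s > 0" if "s > 0" for s
    using that flat_fun_sum_pos[of s] unfolding smooth_step_def divide_inverse[symmetric]
    by (simp add: flat_fun_def)
  have "\<exists>D. (k has_real_derivative D) (at s) \<and> (s > 0 \<longrightarrow> D > 0) \<and> D \<ge> 0" for s
  proof -
    obtain D where D: "(smooth_step has_real_derivative D) (at (inverse \<eta> * s + 0))" "D \<ge> 0"
      using smooth_step_derivative_nonneg by blast
    have "((\<lambda>s. inverse \<eta> * s + 0) has_real_derivative inverse \<eta>) (at s)"
      by (auto intro!: derivative_eq_intros)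
    then have "((\<lambda>s. smooth_step (inverse \<eta> * s + 0)) has_real_derivative D * inverse \<eta>) (at s)"
      by (rule DERIV_chain2[of smooth_step D "\<lambda>s. inverse \<eta> * s + 0" s, OF D(1)])
    then have d: "(k has_real_derivative
        smooth_step (inverse \<eta> * s + 0) + s * (D * inverse \<eta>)) (at s)"
      unfolding k_def by (auto intro!: derivative_eq_intros)
    show ?thesis
    proof (cases "s > 0")
      case True
      then have "smooth_step (inverse \<eta> * s + 0) > 0" using p assms by auto
      moreover have "s * (D * inverse \<eta>) \<ge> 0" using True D(2) assms by auto
      ultimately show ?thesis using d by (auto intro!: exI)
    next
      case False
      \<comment> \<open>On the closed left half-line \<open>k\<close> vanishes, and so does its derivative.\<close>
      have "(k has_real_derivative 0) (at s)" 
      proof (cases "s = 0")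
        case True
        then show ?thesis using d z[of 0] by simp
      next
        case neg: False
        have "((\<lambda>_. 0) has_real_derivative 0) (at s)" by simp
        then show ?thesis
          by (rule has_field_derivative_transform_within_open[where S="{..<0}"])
            (use False neg assms in \<open>auto simp: k_def z mult_nonneg_nonpos\<close>)
      qed
      then show ?thesis using False by auto
    qed
  qed
  then obtain k' where k': "\<And>s. (k has_real_derivative k' s) (at s) \<and> (s > 0 \<longrightarrow> k' s > 0) \<and> k' s \<ge> 0"
    by metis
  show ?thesis
  proof (rule that[of k k'])
    show "smooth_on UNIV k"
      unfolding k_def
      by (intro smooth_on_mult smooth_on_compose[OF _ _ _ smooth_on_affine(1) smooth_on_smooth_step]
          smooth_on_bounded_linear bounded_linear_ident) auto
    show k0: "k s = 0" if "s \<le> 0" for s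
      using that assms by (simp add: k_def z mult_nonneg_nonpos)
    show "0 \<le> k s \<and> k s \<le> \<bar>s\<bar>" for s
    proof (cases "s \<le> 0")
      case False
      then show ?thesis
        using 01[of "inverse \<eta> * s + 0"] unfolding k_def by (simp add: mult_left_le)
    qed (simp add: k0)
    show "k s = s" if "s \<ge> \<eta>" for s
    proof -
      have "inverse \<eta> * s + 0 \<ge> 1" using that assms by (simp add: field_simps)
      then show ?thesis using one by (simp add: k_def)
    qed
  qed (use k' in auto)
qed

section \<open>Charts and tangent vectors\<close>

lemma chart_inv_chart: "is_chart M c \<Longrightarrow> p \<in> fst c \<Longrightarrow> chart_inv c (snd c p) = p"
  unfolding is_chart_def chart_inv_def
  by (metis homeomorphic_imp_injective_map inf.absorb_iff2 inv_into_f_f openin_subset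
      topspace_subtopology)

lemma chart_chart_inv: "x \<in> snd c ` fst c \<Longrightarrow> snd c (chart_inv c x) = x"
  unfolding chart_inv_def by (rule f_inv_into_f)

lemma chart_inv_in: "x \<in> snd c ` fst c \<Longrightarrow> chart_inv c x \<in> fst c"
  unfolding chart_inv_def by (rule inv_into_into)

lemma open_chart_image:
  assumes "is_chart M c" "openin M W"
  shows "open (snd c ` (fst c \<inter> W))"
proof -
  have "open_map (subtopology M (fst c)) (top_of_set (snd c ` fst c)) (snd c)"
    using assms(1) by (simp add: is_chart_def homeomorphic_imp_open_map)
  moreover have "openin (subtopology M (fst c)) (fst c \<inter> W)"
    using assms(2) by (auto simp: openin_subtopology)
  ultimately have "openin (top_of_set (snd c ` fst c)) (snd c ` (fst c \<inter> W))"
    by (simp add: open_map_def)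
  then show ?thesis
    using assms(1) openin_open_trans by (auto simp: is_chart_def)
qed

lemma openin_chart_preimage:
  assumes "is_chart M c" "open B"
  shows "openin M {p \<in> fst c. snd c p \<in> B}"
proof -
  have "continuous_map (subtopology M (fst c)) (top_of_set (snd c ` fst c)) (snd c)"
    using assms(1) by (simp add: is_chart_def homeomorphic_imp_continuous_map)
  then have "continuous_map (subtopology M (fst c)) euclidean (snd c)"
    by (simp add: continuous_map_in_subtopology)
  then have "openin (subtopology M (fst c)) {p \<in> topspace (subtopology M (fst c)). snd c p \<in> B}"
    using assms(2) by (intro openin_continuous_map_preimage) auto
  moreover have "openin M (fst c)" "topspace (subtopology M (fst c)) = fst c"
    using assms(1) openin_subset by (auto simp: is_chart_def)
  ultimately show ?thesis
    using openin_trans_full by fastforce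
qed

locale smooth_mfd =
  fixes M :: "'a topology" and A :: "('a, 'e::euclidean_space) chart set"
  assumes manifold: "smooth_manifold M A"
begin

lemma chartD: "c \<in> A \<Longrightarrow> is_chart M c"
  using manifold by (simp add: smooth_manifold_def)

lemma topspace_chart: "p \<in> topspace M \<Longrightarrow> \<exists>c\<in>A. p \<in> fst c"
  using manifold by (auto simp: smooth_manifold_def)

lemma chart_in_topspace: "c \<in> A \<Longrightarrow> p \<in> fst c \<Longrightarrow> p \<in> topspace M"
  using manifold by (auto simp: smooth_manifold_def)

lemma open_overlap: "c \<in> A \<Longrightarrow> d \<in> A \<Longrightarrow> open (snd c ` (fst c \<inter> fst d))"
  using open_chart_image[OF chartD] chartD[of d] by (simp add: is_chart_def)

lemma smooth_transition: "c \<in> A \<Longrightarrow> d \<in> A \<Longrightarrow> smooth_on (snd c ` (fst c \<inter> fst d)) (transition c d)"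
  using manifold by (simp add: smooth_manifold_def)

lemma transition_chart: "c \<in> A \<Longrightarrow> p \<in> fst c \<Longrightarrow> transition c d (snd c p) = snd d p"
  using chart_inv_chart[OF chartD] by (simp add: transition_def)

lemma transition_has_derivative:
  assumes "c \<in> A" "d \<in> A" "p \<in> fst c" "p \<in> fst d"
  shows "(transition c d has_derivative frechet_derivative (transition c d) (at (snd c p)))
    (at (snd c p))"
  using smooth_on_imp_differentiable[OF smooth_transition] assms
  by (simp add: frechet_derivative_works[symmetric])

text \<open>The cocycle rule makes the family of coordinate vectors in \<open>coord_vec\<close> a tangent vector. Each
  chart around \<open>p\<close> thus identifies the tangent space with the model space.\<close>

lemma transition_cocycle:
  assumes "c \<in> A" "d \<in> A" "d' \<in> A" "p \<in> fst c" "p \<in> fst d" "p \<in> fst d'"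
  shows "frechet_derivative (transition c d') (at (snd c p)) e =
    frechet_derivative (transition d d') (at (snd d p))
      (frechet_derivative (transition c d) (at (snd c p)) e)"
proof -
  have td: "transition c d (snd c p) = snd d p"
    using assms transition_chart by blast
  have "((\<lambda>x. transition d d' (transition c d x)) has_derivative
      (\<lambda>e. frechet_derivative (transition d d') (at (snd d p))
        (frechet_derivative (transition c d) (at (snd c p)) e))) (at (snd c p))"
    using has_derivative_compose[OF transition_has_derivative[of c d p]]
      transition_has_derivative[of d d' p] assms td by auto
  then have "(transition c d' has_derivative
      (\<lambda>e. frechet_derivative (transition d d') (at (snd d p))
        (frechet_derivative (transition c d) (at (snd c p)) e))) (at (snd c p))"
    by (rule has_derivative_transform_within_open[OF _ open_overlap[OF assms(1,2)]])
      (use assms in \<open>auto simp: transition_chart\<close>)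
  then show ?thesis
    using frechet_derivative_at by metis
qed

lemma transition_refl_derivative:
  assumes "c \<in> A" "p \<in> fst c"
  shows "frechet_derivative (transition c c) (at (snd c p)) e = e"
proof -
  have "((\<lambda>x. x) has_derivative (\<lambda>e. e)) (at (snd c p))"
    by (rule has_derivative_ident)
  then have "(transition c c has_derivative (\<lambda>e. e)) (at (snd c p))"
    by (rule has_derivative_transform_within_open[OF _ open_overlap[OF assms(1,1)]])
      (use assms in \<open>auto simp: transition_chart\<close>)
  then show ?thesis
    using frechet_derivative_at by metis
qed

lemma coord_vec_chart: "c \<in> A \<Longrightarrow> p \<in> fst c \<Longrightarrow> coord_vec A c e p c = e"
  by (simp add: coord_vec_def transition_refl_derivative)

lemma coord_vec_in_tangent_space:
  assumes "c \<in> A" "p \<in> fst c"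
  shows "coord_vec A c e p \<in> tangent_space A p"
proof -
  have "coord_vec A c e p d' =
      frechet_derivative (transition d d') (at (snd d p)) (coord_vec A c e p d)"
    if "d \<in> A" "d' \<in> A" "p \<in> fst d" "p \<in> fst d'" for d d'
    using transition_cocycle[OF assms(1) that(1,2) assms(2) that(3,4)] that
    by (simp add: coord_vec_def)
  moreover have "coord_vec A c e p d = 0" if "\<not> (d \<in> A \<and> p \<in> fst d)" for d
    using that by (simp only: coord_vec_def if_False)
  ultimately show ?thesis
    unfolding tangent_space_def by blast
qed

lemma tangent_vector_eq_coord_vec:
  assumes "c \<in> A" "p \<in> fst c" "v \<in> tangent_space A p"
  shows "v = coord_vec A c (v c) p"
proof
  fix d
  show "v d = coord_vec A c (v c) p d"
  proof (cases "d \<in> A \<and> p \<in> fst d")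
    case True
    then have "v d = frechet_derivative (transition c d) (at (snd c p)) (v c)"
      using assms unfolding tangent_space_def by blast
    then show ?thesis
      using True by (simp add: coord_vec_def)
  next
    case False
    then have "v d = 0"
      using assms(3) unfolding tangent_space_def by blast
    then show ?thesis
      using False by (simp only: coord_vec_def if_False)
  qed
qed

lemma coord_vec_lincomb:
  assumes "c \<in> A" "p \<in> fst c"
  shows "coord_vec A c (a *\<^sub>R e + b *\<^sub>R e') p =
    (\<lambda>d. a *\<^sub>R coord_vec A c e p d + b *\<^sub>R coord_vec A c e' p d)"
proof
  fix d
  show "coord_vec A c (a *\<^sub>R e + b *\<^sub>R e') p d =
      a *\<^sub>R coord_vec A c e p d + b *\<^sub>R coord_vec A c e' p d"
  proof (cases "d \<in> A \<and> p \<in> fst d")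
    case True
    have "linear (frechet_derivative (transition c d) (at (snd c p)))"
      using transition_has_derivative assms True has_derivative_linear by blast
    then show ?thesis
      using True by (simp add: coord_vec_def linear_add linear_cmul)
  qed (auto simp: coord_vec_def)
qed

lemma tangent_space_lincomb:
  assumes "p \<in> topspace M" "u \<in> tangent_space A p" "v \<in> tangent_space A p"
  shows "(\<lambda>c. a *\<^sub>R u c + b *\<^sub>R v c) \<in> tangent_space A p"
proof -
  obtain c where c: "c \<in> A" "p \<in> fst c"
    using topspace_chart[OF assms(1)] by blast
  have "(\<lambda>d. a *\<^sub>R u d + b *\<^sub>R v d) = coord_vec A c (a *\<^sub>R u c + b *\<^sub>R v c) p"
    by (simp only: coord_vec_lincomb[OF c] tangent_vector_eq_coord_vec[OF c assms(2), symmetric]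
        tangent_vector_eq_coord_vec[OF c assms(3), symmetric])
  then show ?thesis
    using coord_vec_in_tangent_space[OF c] by simp
qed

section \<open>Curves\<close>

text \<open>Smoothness of a curve at a parameter is asked in a single chart, as a condition on the germ
  of the curve there; this is what makes it easy to verify for curves that are pieced together.\<close>

definition curve_smooth_at :: "(real \<Rightarrow> 'a) \<Rightarrow> real \<Rightarrow> bool" where
  "curve_smooth_at \<gamma> t \<longleftrightarrow> (\<exists>c\<in>A. \<exists>U. open U \<and> t \<in> U \<and> \<gamma> ` U \<subseteq> fst c \<and> smooth_on U (snd c \<circ> \<gamma>))"

lemma curve_smooth_at_continuous:
  assumes "curve_smooth_at \<gamma> t" "openin M W" "\<gamma> t \<in> W"
  shows "\<exists>U. open U \<and> t \<in> U \<and> \<gamma> ` U \<subseteq> W"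
proof -
  obtain c U where c: "c \<in> A" and U: "open U" "t \<in> U" "\<gamma> ` U \<subseteq> fst c" "smooth_on U (snd c \<circ> \<gamma>)"
    using assms(1) by (auto simp: curve_smooth_at_def)
  let ?V = "U \<inter> (snd c \<circ> \<gamma>) -` (snd c ` (fst c \<inter> W))"
  have "open ?V"
    using continuous_open_preimage[OF smooth_on_imp_continuous_on[OF U(4)] U(1)]
      open_chart_image[OF chartD[OF c] assms(2)] by blast
  moreover have "\<gamma> s \<in> W" if s: "s \<in> ?V" for s
  proof -
    obtain q where "q \<in> fst c" "q \<in> W" "snd c (\<gamma> s) = snd c q"
      using s by auto
    then have "\<gamma> s = q"
      using chart_inv_chart[OF chartD[OF c]] s U(3) by (metis IntD1 image_subset_iff)
    then show ?thesis using \<open>q \<in> W\<close> by simp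
  qed
  moreover have "t \<in> ?V"
    using U assms(3) by auto
  ultimately show ?thesis by blast
qed

lemma curve_smooth_at_chart:
  assumes "curve_smooth_at \<gamma> t" "d \<in> A" "\<gamma> t \<in> fst d"
  shows "\<exists>U. open U \<and> t \<in> U \<and> \<gamma> ` U \<subseteq> fst d \<and> smooth_on U (snd d \<circ> \<gamma>)"
proof -
  obtain c U where c: "c \<in> A" and U: "open U" "t \<in> U" "\<gamma> ` U \<subseteq> fst c" "smooth_on U (snd c \<circ> \<gamma>)"
    using assms(1) by (auto simp: curve_smooth_at_def)
  obtain V where V: "open V" "t \<in> V" "\<gamma> ` V \<subseteq> fst d"
    using curve_smooth_at_continuous[OF assms(1) _ assms(3)] chartD[OF assms(2)]
    by (auto simp: is_chart_def)
  have "smooth_on (U \<inter> V) (\<lambda>s. transition c d ((snd c \<circ> \<gamma>) s))"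
    by (rule smooth_on_compose[OF _ open_overlap[OF c assms(2)] _ smooth_on_subset[OF U(4)]
          smooth_transition[OF c assms(2)]])
      (use U V in auto)
  then have "smooth_on (U \<inter> V) (snd d \<circ> \<gamma>)"
    by (rule smooth_on_cong_imp[rotated 2])
      (use c U V in \<open>auto simp: transition_chart\<close>)
  then show ?thesis
    using U V by (intro exI[of _ "U \<inter> V"]) auto
qed

lemma curve_smooth_at_in_topspace: "curve_smooth_at \<gamma> t \<Longrightarrow> \<gamma> t \<in> topspace M"
  unfolding curve_smooth_at_def using chart_in_topspace by blast

lemma curve_has_vector_derivative:
  assumes "curve_smooth_at \<gamma> t" "c \<in> A" "\<gamma> t \<in> fst c"
  shows "((snd c \<circ> \<gamma>) has_vector_derivative velocity A \<gamma> t c) (at t)"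
  using curve_smooth_at_chart[OF assms] smooth_on_imp_differentiable assms
  by (auto simp: velocity_def vector_derivative_works[symmetric])

lemma velocity_eqI:
  assumes "c \<in> A" "\<gamma> t \<in> fst c" "((snd c \<circ> \<gamma>) has_vector_derivative v) (at t)"
  shows "velocity A \<gamma> t c = v"
  using assms by (simp add: velocity_def vector_derivative_at)

lemma velocity_in_tangent_space:
  assumes "curve_smooth_at \<gamma> t"
  shows "velocity A \<gamma> t \<in> tangent_space A (\<gamma> t)"
proof -
  have "velocity A \<gamma> t d = frechet_derivative (transition c d) (at (snd c (\<gamma> t))) (velocity A \<gamma> t c)"
    if c: "c \<in> A" "\<gamma> t \<in> fst c" and d: "d \<in> A" "\<gamma> t \<in> fst d" for c d
  proof (rule velocity_eqI[where \<gamma>=\<gamma> and t=t, OF d])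
    obtain U where U: "open U" "t \<in> U" "\<gamma> ` U \<subseteq> fst c"
      using curve_smooth_at_chart[OF assms c] by blast
    have lin: "linear (frechet_derivative (transition c d) (at (snd c (\<gamma> t))))"
      using transition_has_derivative c d has_derivative_linear by blast
    have "((\<lambda>s. transition c d ((snd c \<circ> \<gamma>) s)) has_derivative
      (\<lambda>h. frechet_derivative (transition c d) (at (snd c (\<gamma> t))) (h *\<^sub>R velocity A \<gamma> t c))) (at t)"
      using has_derivative_compose[OF curve_has_vector_derivative[OF assms c,
            unfolded has_vector_derivative_def]] transition_has_derivative[OF c(1) d(1) c(2) d(2)]
      by simp
    then have "((\<lambda>s. transition c d ((snd c \<circ> \<gamma>) s)) has_vector_derivative
      frechet_derivative (transition c d) (at (snd c (\<gamma> t))) (velocity A \<gamma> t c)) (at t)"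
      by (simp add: has_vector_derivative_def linear_cmul[OF lin])
    then show "((snd d \<circ> \<gamma>) has_vector_derivative
      frechet_derivative (transition c d) (at (snd c (\<gamma> t))) (velocity A \<gamma> t c)) (at t)"
      by (rule has_vector_derivative_transform_within_open[OF _ U(1,2)])
        (use c U(3) in \<open>auto simp: transition_chart\<close>)
  qed
  moreover have "velocity A \<gamma> t d = 0" if "\<not> (d \<in> A \<and> \<gamma> t \<in> fst d)" for d
    using that by (simp only: velocity_def if_False)
  ultimately show ?thesis
    unfolding tangent_space_def by blast
qed

lemma smooth_loopI:
  assumes "\<And>t. curve_smooth_at \<gamma> t" "\<And>t. \<gamma> (t + 1) = \<gamma> t"
  shows "smooth_loop M A \<gamma>"
  unfolding smooth_loop_def
proof (intro conjI allI ballI)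
  show "continuous_map euclideanreal M \<gamma>"
    unfolding continuous_map_def
  proof (intro conjI allI impI)
    show "\<gamma> \<in> topspace euclideanreal \<rightarrow> topspace M"
      using curve_smooth_at_in_topspace assms(1) by auto
    fix W assume W: "openin M W"
    have "open {t. \<gamma> t \<in> W}"
      unfolding open_subopen[of "{t. \<gamma> t \<in> W}"]
      using curve_smooth_at_continuous[OF assms(1) W] by fastforce
    then show "openin euclideanreal {t \<in> topspace euclideanreal. \<gamma> t \<in> W}"
      by simp
  qed
  show "smooth_on {t. \<gamma> t \<in> fst c} (snd c \<circ> \<gamma>)" if "c \<in> A" for c
    using curve_smooth_at_chart[OF assms(1) that] by (intro smooth_on_local) auto
qed (use assms in auto)

end

section \<open>Positive curves\<close>

locale one_form_mfd = smooth_mfd M A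
  for M :: "'a topology" and A :: "('a, 'e::euclidean_space) chart set" +
  fixes lam :: "('a, 'e) form1"
  assumes form: "one_form M A lam"
begin

lemma form_lincomb:
  assumes "p \<in> topspace M" "u \<in> tangent_space A p" "v \<in> tangent_space A p"
  shows "lam p (\<lambda>c. a *\<^sub>R u c + b *\<^sub>R v c) = a * lam p u + b * lam p v"
  using form assms by (simp add: one_form_def)

lemma smooth_local_form: "c \<in> A \<Longrightarrow> smooth_on (snd c ` fst c) (local_form A c lam e)"
  using form by (simp add: one_form_def)

lemma local_form_chart:
  "c \<in> A \<Longrightarrow> p \<in> fst c \<Longrightarrow> local_form A c lam e (snd c p) = lam p (coord_vec A c e p)"
  by (simp add: local_form_def chart_inv_chart[OF chartD])

lemma local_form_lincomb:
  assumes "c \<in> A" "x \<in> snd c ` fst c"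
  shows "local_form A c lam (a *\<^sub>R e + b *\<^sub>R e') x =
    a * local_form A c lam e x + b * local_form A c lam e' x"
proof -
  have p: "chart_inv c x \<in> fst c" using chart_inv_in[OF assms(2)] .
  show ?thesis
    unfolding local_form_def coord_vec_lincomb[OF assms(1) p]
    by (rule form_lincomb[OF chart_in_topspace[OF assms(1) p]
          coord_vec_in_tangent_space[OF assms(1) p] coord_vec_in_tangent_space[OF assms(1) p]])
qed

lemma linear_local_form:
  assumes "c \<in> A" "x \<in> snd c ` fst c"
  shows "linear (\<lambda>e. local_form A c lam e x)"
  using local_form_lincomb[OF assms, of 1 _ 1] local_form_lincomb[OF assms, of _ _ 0]
  by (intro linearI) auto

text \<open>Expanding in a basis, the pairing is a finite sum of products of continuous functions, hence
  jointly continuous in the point and the vector.\<close>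

lemma local_form_pos_nbhd:
  assumes c: "c \<in> A" and x: "x \<in> snd c ` fst c" and pos: "local_form A c lam e x > 0"
  obtains r where "r > 0" "ball x r \<subseteq> snd c ` fst c"
    "\<And>y e'. y \<in> ball x r \<Longrightarrow> e' \<in> ball e r \<Longrightarrow> local_form A c lam e' y > 0"
proof -
  let ?U = "snd c ` fst c"
  let ?G = "\<lambda>z. \<Sum>b\<in>Basis. (snd z \<bullet> b) * local_form A c lam b (fst z)"
  have G: "?G (y, e') = local_form A c lam e' y" if "y \<in> ?U" for y e'
    using linear_euclidean_expansion[OF linear_local_form[OF c that], of e'] by simp
  have oU: "open ?U" using chartD[OF c] by (simp add: is_chart_def)
  have "continuous_on (?U \<times> UNIV) (\<lambda>z. local_form A c lam b (fst z))" for b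
    by (rule continuous_on_compose2[OF smooth_on_imp_continuous_on[OF smooth_local_form[OF c]]
          continuous_on_fst[OF continuous_on_id]]) auto
  then have "continuous_on (?U \<times> UNIV) ?G"
    by (intro continuous_intros)
  then have "open ((?U \<times> UNIV) \<inter> ?G -` {0<..})"
    using oU by (intro continuous_open_preimage open_Times) auto
  moreover have "(x, e) \<in> (?U \<times> UNIV) \<inter> ?G -` {0<..}"
    using x pos G[OF x, of e] by simp
  ultimately obtain B C where BC: "open B" "open C" "(x, e) \<in> B \<times> C"
    "B \<times> C \<subseteq> (?U \<times> UNIV) \<inter> ?G -` {0<..}"
    by (rule open_prod_elim)
  obtain r1 where r1: "r1 > 0" "ball x r1 \<subseteq> B"
    using openE[OF BC(1), of x] BC(3) by blast
  obtain r2 where r2: "r2 > 0" "ball e r2 \<subseteq> C"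
    using openE[OF BC(2), of e] BC(3) by blast
  show ?thesis
  proof (rule that[of "min r1 r2"])
    show "ball x (min r1 r2) \<subseteq> ?U"
    proof
      fix y assume "y \<in> ball x (min r1 r2)"
      then have "(y, e) \<in> B \<times> C" using r1 BC(3) by auto
      then show "y \<in> ?U" using BC(4) by blast
    qed
    fix y e' assume "y \<in> ball x (min r1 r2)" "e' \<in> ball e (min r1 r2)"
    then have "(y, e') \<in> B \<times> C" using r1 r2 by auto
    then have "y \<in> ?U" "?G (y, e') > 0" using BC(4) by auto
    then show "local_form A c lam e' y > 0" using G by simp
  qed (use r1 r2 in auto)
qed

definition positive_at :: "(real \<Rightarrow> 'a) \<Rightarrow> real \<Rightarrow> bool" where
  "positive_at \<gamma> t \<longleftrightarrow> curve_smooth_at \<gamma> t \<and> lam (\<gamma> t) (velocity A \<gamma> t) > 0"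

lemma form_velocity_chart:
  assumes "curve_smooth_at \<gamma> t" "c \<in> A" "\<gamma> t \<in> fst c"
  shows "lam (\<gamma> t) (velocity A \<gamma> t) = local_form A c lam (velocity A \<gamma> t c) (snd c (\<gamma> t))"
  using tangent_vector_eq_coord_vec[OF assms(2,3) velocity_in_tangent_space[OF assms(1)]]
    local_form_chart[OF assms(2,3)] by simp

lemma positive_at_chart_invI:
  assumes c: "c \<in> A" and U: "open U" "t \<in> U" and f: "smooth_on U f" "f ` U \<subseteq> snd c ` fst c"
    and v: "(f has_vector_derivative v) (at t)" "local_form A c lam v (f t) > 0"
  shows "positive_at (\<lambda>s. chart_inv c (f s)) t"
proof -
  let ?\<gamma> = "\<lambda>s. chart_inv c (f s)"
  have eq: "f s = (snd c \<circ> ?\<gamma>) s" and inc: "?\<gamma> s \<in> fst c" if "s \<in> U" for s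
    using that f(2) chart_chart_inv[of "f s" c] chart_inv_in[of "f s" c] by auto
  have sm: "curve_smooth_at ?\<gamma> t"
    unfolding curve_smooth_at_def
    using c U inc smooth_on_cong_imp[OF U(1) eq f(1)] by blast
  have "((snd c \<circ> ?\<gamma>) has_vector_derivative v) (at t)"
    by (rule has_vector_derivative_transform_within_open[OF v(1) U eq])
  then have "velocity A ?\<gamma> t c = v"
    by (intro velocity_eqI[OF c] inc U)
  moreover have "snd c (?\<gamma> t) = f t"
    using eq[OF U(2)] by (simp only: o_def)
  ultimately show ?thesis
    unfolding positive_at_def using sm form_velocity_chart[OF sm c] inc[OF U(2)] v(2) by simp
qed

text \<open>Positivity at a parameter depends only on the germ of the curve. Curves defined by cases are
  treated by comparing them with one of their pieces on a small interval.\<close>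

lemma positive_at_germ:
  assumes "positive_at \<gamma> t" "open U" "t \<in> U" "\<And>s. s \<in> U \<Longrightarrow> \<gamma> s = \<gamma>' s"
  shows "positive_at \<gamma>' t"
proof -
  have sm: "curve_smooth_at \<gamma> t" using assms(1) by (simp add: positive_at_def)
  then obtain c V where c: "c \<in> A" and V: "open V" "t \<in> V" "\<gamma> ` V \<subseteq> fst c" "smooth_on V (snd c \<circ> \<gamma>)"
    by (auto simp: curve_smooth_at_def)
  have "smooth_on (U \<inter> V) (snd c \<circ> \<gamma>')"
    by (rule smooth_on_cong_imp[OF _ _ smooth_on_subset[OF V(4)]]) (use assms V in auto)
  moreover have "\<gamma>' ` (U \<inter> V) \<subseteq> fst c"
    using assms(4) V(3) by (metis IntD1 IntD2 image_subset_iff)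
  ultimately have sm': "curve_smooth_at \<gamma>' t"
    using c V assms(2,3) unfolding curve_smooth_at_def by blast
  have t: "\<gamma>' t = \<gamma> t" "\<gamma> t \<in> fst c" using assms(3,4) V by auto
  have "((snd c \<circ> \<gamma>') has_vector_derivative velocity A \<gamma> t c) (at t)"
    by (rule has_vector_derivative_transform_within_open[OF
          curve_has_vector_derivative[OF sm c t(2)] assms(2,3)]) (use assms in auto)
  then have "velocity A \<gamma>' t c = velocity A \<gamma> t c"
    by (intro velocity_eqI[OF c]) (use t in auto)
  then show ?thesis
    using assms(1) form_velocity_chart[OF sm c] form_velocity_chart[OF sm' c] sm' t
    by (simp add: positive_at_def)
qed

lemma positive_at_affine:
  assumes "positive_at \<gamma> (L * t + b)" "L > 0"
  shows "positive_at (\<lambda>s. \<gamma> (L * s + b)) t"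
proof -
  let ?\<gamma> = "\<lambda>s. \<gamma> (L * s + b)" and ?t = "L * t + b"
  have sm: "curve_smooth_at \<gamma> ?t" using assms(1) by (simp add: positive_at_def)
  then obtain c V where c: "c \<in> A" and V: "open V" "?t \<in> V" "\<gamma> ` V \<subseteq> fst c" "smooth_on V (snd c \<circ> \<gamma>)"
    by (auto simp: curve_smooth_at_def)
  let ?W = "(\<lambda>s. L * s + b) -` V"
  have W: "open ?W" by (intro open_vimage V continuous_intros)
  have "smooth_on ?W (\<lambda>s. (snd c \<circ> \<gamma>) (L * s + b))"
    by (rule smooth_on_compose[OF W V(1) _ smooth_on_affine(1)[OF W] V(4)]) auto
  then have sm': "curve_smooth_at ?\<gamma> t"
    using c V W unfolding curve_smooth_at_def by (intro bexI[OF _ c] exI[of _ ?W]) (auto simp: o_def)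
  have t: "\<gamma> ?t \<in> fst c" using V by auto
  have "((\<lambda>s. L * s + b) has_vector_derivative L) (at t)"
    by (auto intro!: derivative_eq_intros)
  then have "((snd c \<circ> ?\<gamma>) has_vector_derivative L *\<^sub>R velocity A \<gamma> ?t c) (at t)"
    using vector_diff_chain_at[where f="\<lambda>s. L * s + b" and x=t, OF _ curve_has_vector_derivative[OF sm c t]]
    by (simp add: o_def)
  then have v: "velocity A ?\<gamma> t c = L *\<^sub>R velocity A \<gamma> ?t c"
    by (intro velocity_eqI[OF c]) (use t in auto)
  have "local_form A c lam (L *\<^sub>R velocity A \<gamma> ?t c) (snd c (\<gamma> ?t)) =
      L * local_form A c lam (velocity A \<gamma> ?t c) (snd c (\<gamma> ?t))"
    using local_form_lincomb[OF c, of "snd c (\<gamma> ?t)" L _ 0 0] t by simp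
  then show ?thesis
    using assms form_velocity_chart[OF sm c t] form_velocity_chart[OF sm' c t] sm' v
    by (simp add: positive_at_def)
qed

lemma curve_chart_nbhd:
  assumes "curve_smooth_at \<gamma> t" "c \<in> A" "\<gamma> t \<in> fst c" "r > 0"
  obtains \<epsilon> f' where "\<epsilon> > 0" "\<gamma> ` ball t \<epsilon> \<subseteq> fst c" "smooth_on (ball t \<epsilon>) (snd c \<circ> \<gamma>)"
    "\<And>s. s \<in> ball t \<epsilon> \<Longrightarrow> ((snd c \<circ> \<gamma>) has_vector_derivative f' s) (at s)"
    "\<And>s. s \<in> ball t \<epsilon> \<Longrightarrow> f' s \<in> ball (velocity A \<gamma> t c) r"
    "\<And>s. s \<in> ball t \<epsilon> \<Longrightarrow> snd c (\<gamma> s) \<in> ball (snd c (\<gamma> t)) r"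
proof -
  let ?f = "snd c \<circ> \<gamma>"
  let ?f' = "\<lambda>s. frechet_derivative ?f (at s) 1"
  obtain U where U: "open U" "t \<in> U" "\<gamma> ` U \<subseteq> fst c" "smooth_on U ?f"
    using curve_smooth_at_chart[OF assms(1-3)] by blast
  have d: "(?f has_vector_derivative ?f' s) (at s)" if "s \<in> U" for s
  proof -
    have "(?f has_derivative frechet_derivative ?f (at s)) (at s)"
      using smooth_on_imp_differentiable[OF U(4) that] frechet_derivative_works by blast
    moreover from this have "frechet_derivative ?f (at s) = (\<lambda>h. h *\<^sub>R ?f' s)"
      using linear_cmul[OF has_derivative_linear, of ?f _ "at s" _ 1] by fastforce
    ultimately show ?thesis
      by (simp add: has_vector_derivative_def)
  qed
  have v: "?f' t = velocity A \<gamma> t c"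
    using vector_derivative_at[OF d[OF U(2)]] assms by (simp add: velocity_def)
  have "open (U \<inter> ?f' -` ball (velocity A \<gamma> t c) r)"
    by (rule continuous_open_preimage[OF smooth_on_imp_continuous_on[OF
            smooth_on_frechet_derivative[OF U(4)]] U(1)]) auto
  moreover have "open (U \<inter> ?f -` ball (snd c (\<gamma> t)) r)"
    by (rule continuous_open_preimage[OF smooth_on_imp_continuous_on[OF U(4)] U(1)]) auto
  ultimately have "open (U \<inter> ?f' -` ball (velocity A \<gamma> t c) r \<inter> (U \<inter> ?f -` ball (snd c (\<gamma> t)) r))"
    (is "open ?V") by blast
  moreover have "t \<in> ?V" using U(2) v assms(4) by simp
  ultimately obtain \<epsilon> where \<epsilon>: "\<epsilon> > 0" "ball t \<epsilon> \<subseteq> ?V"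
    using openE by blast
  show ?thesis
    by (rule that[of \<epsilon> ?f'])
      (use \<epsilon> U(3) d smooth_on_subset[OF U(4), of "ball t \<epsilon>"] in \<open>auto simp: subset_iff\<close>)
qed

text \<open>Rounding a corner. With a ramp \<open>k\<close> and both arcs written in one chart around the corner
  \<open>x\<close>, the curve \<open>S (- k (\<eta> - t)) + T (k (\<eta> + t)) - x\<close> brakes the incoming arc to rest at \<open>x\<close>
  while the outgoing one is already starting. Its velocity is a combination, with nonnegative
  coefficients that do not vanish together, of velocities of the two arcs near the corner, so
  it is positive because positivity is an open and convex condition.\<close>

lemma positive_corner:
  assumes \<sigma>: "positive_at \<sigma> 0" and \<tau>: "positive_at \<tau> 0" and eq: "\<sigma> 0 = \<tau> 0" and "\<delta> > 0"
  obtains \<eta> \<rho> where "0 < \<eta>" "\<eta> < \<delta>" "\<And>t. \<bar>t\<bar> < 3 * \<eta> \<Longrightarrow> positive_at \<rho> t"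
    "\<And>t. - 3 * \<eta> < t \<Longrightarrow> t \<le> - \<eta> \<Longrightarrow> \<rho> t = \<sigma> (t - \<eta>)"
    "\<And>t. \<eta> \<le> t \<Longrightarrow> t < 3 * \<eta> \<Longrightarrow> \<rho> t = \<tau> (t + \<eta>)"
proof -
  have sm: "curve_smooth_at \<sigma> 0" "curve_smooth_at \<tau> 0"
    using \<sigma> \<tau> by (auto simp: positive_at_def)
  obtain c where c: "c \<in> A" and p: "\<sigma> 0 \<in> fst c"
    using topspace_chart curve_smooth_at_in_topspace sm(1) by blast
  have p': "\<tau> 0 \<in> fst c" using p eq by simp
  define x u w where "x = snd c (\<sigma> 0)" and "u = velocity A \<sigma> 0 c" and "w = velocity A \<tau> 0 c"
  have x: "x \<in> snd c ` fst c" using p by (simp add: x_def)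
  have "local_form A c lam u x > 0" "local_form A c lam w x > 0"
    using \<sigma> \<tau> form_velocity_chart[OF sm(1) c p] form_velocity_chart[OF sm(2) c p'] eq
    by (auto simp: positive_at_def x_def u_def w_def)
  then obtain r1 r2 where r1: "r1 > 0" "ball x r1 \<subseteq> snd c ` fst c"
      "\<And>y e. y \<in> ball x r1 \<Longrightarrow> e \<in> ball u r1 \<Longrightarrow> local_form A c lam e y > 0"
    and r2: "r2 > 0"
      "\<And>y e. y \<in> ball x r2 \<Longrightarrow> e \<in> ball w r2 \<Longrightarrow> local_form A c lam e y > 0"
    using local_form_pos_nbhd[OF c x] by metis
  \<comment> \<open>Half of the radius, since the displacements of the two arcs from \<open>x\<close> add up.\<close>
  define r where "r = min r1 r2 / 2"
  have r: "r > 0" using r1(1) r2(1) by (simp add: r_def)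
  define S T where "S = snd c \<circ> \<sigma>" and "T = snd c \<circ> \<tau>"
  obtain \<epsilon>1 S' where S: "\<epsilon>1 > 0" "\<sigma> ` ball 0 \<epsilon>1 \<subseteq> fst c" "smooth_on (ball 0 \<epsilon>1) S"
    "\<And>s. s \<in> ball 0 \<epsilon>1 \<Longrightarrow> (S has_vector_derivative S' s) (at s)"
    "\<And>s. s \<in> ball 0 \<epsilon>1 \<Longrightarrow> S' s \<in> ball u r" "\<And>s. s \<in> ball 0 \<epsilon>1 \<Longrightarrow> S s \<in> ball x r"
    using curve_chart_nbhd[OF sm(1) c p r] unfolding S_def x_def u_def o_def by metis
  obtain \<epsilon>2 T' where T: "\<epsilon>2 > 0" "\<tau> ` ball 0 \<epsilon>2 \<subseteq> fst c" "smooth_on (ball 0 \<epsilon>2) T"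
    "\<And>s. s \<in> ball 0 \<epsilon>2 \<Longrightarrow> (T has_vector_derivative T' s) (at s)"
    "\<And>s. s \<in> ball 0 \<epsilon>2 \<Longrightarrow> T' s \<in> ball w r" "\<And>s. s \<in> ball 0 \<epsilon>2 \<Longrightarrow> T s \<in> ball x r"
    using curve_chart_nbhd[OF sm(2) c p' r] unfolding T_def x_def w_def o_def eq by metis
  \<comment> \<open>For \<open>\<bar>t\<bar> < 3 * \<eta>\<close> the arcs are evaluated at parameters of size less than \<open>4 * \<eta>\<close>.\<close>
  define \<eta> where "\<eta> = min (\<delta> / 2) (min \<epsilon>1 \<epsilon>2 / 4)"
  have \<eta>: "0 < \<eta>" "\<eta> < \<delta>" "4 * \<eta> \<le> \<epsilon>1" "4 * \<eta> \<le> \<epsilon>2"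
    using \<open>\<delta> > 0\<close> S(1) T(1) by (auto simp: \<eta>_def)
  obtain k k' where k: "smooth_on UNIV k" "\<And>s. (k has_real_derivative k' s) (at s)"
    "\<And>s. s \<le> 0 \<Longrightarrow> k s = 0" "\<And>s. s \<ge> \<eta> \<Longrightarrow> k s = s" "\<And>s. 0 \<le> k s \<and> k s \<le> \<bar>s\<bar>"
    "\<And>s. s > 0 \<Longrightarrow> k' s > 0" "\<And>s. k' s \<ge> 0"
    using smooth_ramp_exists[OF \<eta>(1)] by metis
  \<comment> \<open>The factors 1 and the summand 0 exhibit the inner functions as affine maps and products.\<close>
  define f where "f = (\<lambda>t. S (- 1 * k (- 1 * t + \<eta>) + 0) + T (k (1 * t + \<eta>)) + - x)"
  let ?I = "ball 0 (3 * \<eta>) :: real set"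
  have a: "- 1 * k (- 1 * t + \<eta>) + 0 \<in> ball 0 \<epsilon>1" and b: "k (1 * t + \<eta>) \<in> ball 0 \<epsilon>2"
    if "t \<in> ?I" for t
    using that k(5)[of "- 1 * t + \<eta>"] k(5)[of "1 * t + \<eta>"] \<eta> by (auto simp: dist_real_def)
  have f_in: "f t \<in> ball x (min r1 r2)" if "t \<in> ?I" for t
  proof -
    let ?a = "S (- 1 * k (- 1 * t + \<eta>) + 0)" and ?b = "T (k (1 * t + \<eta>))"
    have "norm (?a - x) < r" "norm (?b - x) < r"
      using S(6)[OF a[OF that]] T(6)[OF b[OF that]] by (auto simp: dist_norm norm_minus_commute)
    moreover have "f t - x = (?a - x) + (?b - x)" by (simp add: f_def)
    ultimately have "norm (f t - x) < r + r"
      by (metis norm_add_less)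
    then show ?thesis by (simp add: r_def dist_norm norm_minus_commute)
  qed
  have ka: "smooth_on ?I (\<lambda>t. k (a * t + \<eta>))" for a
    by (rule smooth_on_compose[OF _ open_UNIV _ smooth_on_affine(1) k(1)]) auto
  have "smooth_on ?I f"
    unfolding f_def
    by (intro smooth_on_add smooth_on_const smooth_on_compose[OF _ _ _ _ S(3)]
        smooth_on_compose[OF _ _ _ ka T(3)] smooth_on_mult ka)
      (use a b in auto)
  moreover have "(f has_vector_derivative
      k' (- 1 * t + \<eta>) *\<^sub>R S' (- 1 * k (- 1 * t + \<eta>) + 0) + k' (1 * t + \<eta>) *\<^sub>R T' (k (1 * t + \<eta>))) (at t)"
    if "t \<in> ?I" for t
  proof -
    have ka: "((\<lambda>t. k (a * t + \<eta>)) has_real_derivative k' (a * t + \<eta>) * a) (at t)" for a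
      by (rule DERIV_chain2[of k, OF k(2)]) (auto intro!: derivative_eq_intros)
    have "((\<lambda>t. - 1 * k (- 1 * t + \<eta>) + 0) has_vector_derivative k' (- 1 * t + \<eta>)) (at t)"
      using DERIV_minus[OF ka[of "-1"]] by (simp add: has_real_derivative_iff_has_vector_derivative)
    then have 1: "((\<lambda>t. S (- 1 * k (- 1 * t + \<eta>) + 0)) has_vector_derivative
        k' (- 1 * t + \<eta>) *\<^sub>R S' (- 1 * k (- 1 * t + \<eta>) + 0)) (at t)"
      using vector_diff_chain_at[where f="\<lambda>t. - 1 * k (- 1 * t + \<eta>) + 0" and x=t, OF _ S(4)[OF a[OF that]]] by (simp only: o_def)
    have "((\<lambda>t. k (1 * t + \<eta>)) has_vector_derivative k' (1 * t + \<eta>)) (at t)"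
      using ka[of 1] by (simp add: has_real_derivative_iff_has_vector_derivative)
    then have 2: "((\<lambda>t. T (k (1 * t + \<eta>))) has_vector_derivative
        k' (1 * t + \<eta>) *\<^sub>R T' (k (1 * t + \<eta>))) (at t)"
      using vector_diff_chain_at[where f="\<lambda>t. k (1 * t + \<eta>)" and x=t, OF _ T(4)[OF b[OF that]]] by (simp only: o_def)
    show ?thesis
      unfolding f_def
      using has_vector_derivative_add[OF has_vector_derivative_add[OF 1 2]
          has_vector_derivative_const[of "- x"]]
      by simp
  qed
  moreover have "local_form A c lam (k' (- 1 * t + \<eta>) *\<^sub>R S' (- 1 * k (- 1 * t + \<eta>) + 0) +
      k' (1 * t + \<eta>) *\<^sub>R T' (k (1 * t + \<eta>))) (f t) > 0" if "t \<in> ?I" for t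
  proof -
    have ft: "f t \<in> ball x r1" "f t \<in> ball x r2" using f_in[OF that] by auto
    have P: "local_form A c lam (S' (- 1 * k (- 1 * t + \<eta>) + 0)) (f t) > 0"
      using S(5)[OF a[OF that]] r r2(1) by (intro r1(3)[OF ft(1)]) (auto simp: r_def)
    have Q: "local_form A c lam (T' (k (1 * t + \<eta>))) (f t) > 0"
      using T(5)[OF b[OF that]] r r1(1) by (intro r2(2)[OF ft(2)]) (auto simp: r_def)
    have "k' (- 1 * t + \<eta>) > 0 \<or> k' (1 * t + \<eta>) > 0"
      using k(6)[of "- 1 * t + \<eta>"] k(6)[of "1 * t + \<eta>"] \<eta>(1) by linarith
    moreover have "k' (- 1 * t + \<eta>) * local_form A c lam (S' (- 1 * k (- 1 * t + \<eta>) + 0)) (f t) \<ge> 0"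
        "k' (1 * t + \<eta>) * local_form A c lam (T' (k (1 * t + \<eta>))) (f t) \<ge> 0"
      by (intro mult_nonneg_nonneg k(7) less_imp_le[OF P] less_imp_le[OF Q])+
    ultimately have "k' (- 1 * t + \<eta>) * local_form A c lam (S' (- 1 * k (- 1 * t + \<eta>) + 0)) (f t) +
        k' (1 * t + \<eta>) * local_form A c lam (T' (k (1 * t + \<eta>))) (f t) > 0"
      using mult_pos_pos[OF _ P] mult_pos_pos[OF _ Q] by (metis add_pos_nonneg add_nonneg_pos)
    then show ?thesis
      using local_form_lincomb[OF c, of "f t"] ft(1) r1(2) by auto
  qed
  ultimately have pos: "positive_at (\<lambda>t. chart_inv c (f t)) t" if "t \<in> ?I" for t
    using that f_in r1(2) by (intro positive_at_chart_invI[OF c open_ball that]) fastforce+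
  show ?thesis
  proof (rule that[OF \<eta>(1,2)])
    show "positive_at (\<lambda>t. chart_inv c (f t)) t" if "\<bar>t\<bar> < 3 * \<eta>" for t
      using that by (intro pos) (auto simp: dist_real_def)
    fix t
    have T0: "T 0 = x" "S 0 = x" by (auto simp: T_def S_def x_def eq)
    show "chart_inv c (f t) = \<sigma> (t - \<eta>)" if "- 3 * \<eta> < t" "t \<le> - \<eta>"
    proof -
      have "k (1 * t + \<eta>) = 0" "k (- 1 * t + \<eta>) = - 1 * t + \<eta>"
        using that \<eta>(1) by (auto intro!: k(3,4))
      then have "f t = snd c (\<sigma> (t - \<eta>))" by (simp add: f_def T0) (simp add: S_def)
      moreover have "\<sigma> (t - \<eta>) \<in> fst c"
        using S(2) that \<eta> by (auto simp: dist_real_def image_subset_iff)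
      ultimately show ?thesis using chart_inv_chart[OF chartD[OF c]] by simp
    qed
    show "chart_inv c (f t) = \<tau> (t + \<eta>)" if "\<eta> \<le> t" "t < 3 * \<eta>"
    proof -
      have "k (- 1 * t + \<eta>) = 0" "k (1 * t + \<eta>) = 1 * t + \<eta>"
        using that \<eta>(1) by (auto intro!: k(3,4))
      then have "f t = snd c (\<tau> (t + \<eta>))" by (simp add: f_def T0) (simp add: T_def)
      moreover have "\<tau> (t + \<eta>) \<in> fst c"
        using T(2) that \<eta> by (auto simp: dist_real_def image_subset_iff)
      ultimately show ?thesis using chart_inv_chart[OF chartD[OF c]] by simp
    qed
  qed
qed

section \<open>Concatenation of positive curves and positive loops\<close>

text \<open>This relation is the chronological order of Lorentzian geometry, with the half-spaces
  \<open>\<lambda> > 0\<close> in place of the cones of future timelike vectors.\<close>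

definition positively_connected :: "'a \<Rightarrow> 'a \<Rightarrow> bool" where
  "positively_connected p q \<longleftrightarrow>
     (\<exists>T>0. \<exists>\<gamma>. \<gamma> 0 = p \<and> \<gamma> T = q \<and> (\<forall>t\<in>{0..T}. positive_at \<gamma> t))"

lemma positive_at_shift: "positive_at \<gamma> (t + b) \<Longrightarrow> positive_at (\<lambda>s. \<gamma> (s + b)) t"
  using positive_at_affine[of \<gamma> 1 t b] by simp

lemma positively_connected_trans:
  assumes "positively_connected p q" "positively_connected q r"
  shows "positively_connected p r"
proof -
  obtain a \<sigma>0 where \<sigma>0: "a > 0" "\<sigma>0 0 = p" "\<sigma>0 a = q" "\<And>t. t \<in> {0..a} \<Longrightarrow> positive_at \<sigma>0 t"
    using assms(1) unfolding positively_connected_def by blast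
  obtain b \<tau> where \<tau>: "b > 0" "\<tau> 0 = q" "\<tau> b = r" "\<And>t. t \<in> {0..b} \<Longrightarrow> positive_at \<tau> t"
    using assms(2) unfolding positively_connected_def by blast
  define \<sigma> where "\<sigma> = (\<lambda>t. \<sigma>0 (t + a))"
  have \<sigma>: "positive_at \<sigma> t" if "t \<in> {- a..0}" for t
    unfolding \<sigma>_def by (rule positive_at_shift, rule \<sigma>0(4)) (use that in auto)
  have "positive_at \<sigma> 0" "positive_at \<tau> 0" "\<sigma> 0 = \<tau> 0" "min a b / 4 > 0"
    using \<sigma> \<tau> \<sigma>0 by (auto simp: \<sigma>_def)
  then obtain \<eta> \<rho> where \<eta>: "0 < \<eta>" "\<eta> < min a b / 4"
    and \<rho>: "\<And>t. \<bar>t\<bar> < 3 * \<eta> \<Longrightarrow> positive_at \<rho> t"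
    "\<And>t. - 3 * \<eta> < t \<Longrightarrow> t \<le> - \<eta> \<Longrightarrow> \<rho> t = \<sigma> (t - \<eta>)"
    "\<And>t. \<eta> \<le> t \<Longrightarrow> t < 3 * \<eta> \<Longrightarrow> \<rho> t = \<tau> (t + \<eta>)"
    by (rule positive_corner) blast
  define B where "B = (\<lambda>t. if t \<le> - 2 * \<eta> then \<sigma> (t - \<eta>) else if t < 2 * \<eta> then \<rho> t else \<tau> (t + \<eta>))"
  have B: "positive_at B t" if t: "- a + \<eta> \<le> t" "t \<le> b - \<eta>" for t
  proof -
    consider "t < - 2 * \<eta>" | "\<bar>t\<bar> < 3 * \<eta>" | "t > 2 * \<eta>" using \<eta>(1) by linarith
    then show ?thesis
    proof cases
      case 1
      have "positive_at \<sigma> (t + - \<eta>)" using 1 t \<eta> by (intro \<sigma>) auto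
      then have "positive_at (\<lambda>s. \<sigma> (s + - \<eta>)) t" by (rule positive_at_shift)
      then show ?thesis
        by (rule positive_at_germ[where U="{..<- 2 * \<eta>}"]) (use 1 in \<open>auto simp: B_def\<close>)
    next
      case 2
      show ?thesis
        by (rule positive_at_germ[OF \<rho>(1)[OF 2], where U="{- 3 * \<eta><..<3 * \<eta>}"])
          (use 2 \<eta> \<rho> in \<open>auto simp: B_def\<close>)
    next
      case 3
      have "positive_at \<tau> (t + \<eta>)" using 3 t \<eta> by (intro \<tau>) auto
      then have "positive_at (\<lambda>s. \<tau> (s + \<eta>)) t" by (rule positive_at_shift)
      then show ?thesis
        by (rule positive_at_germ[where U="{2 * \<eta><..}"]) (use 3 \<eta> in \<open>auto simp: B_def\<close>)
    qed
  qed
  show ?thesis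
    unfolding positively_connected_def
  proof (intro exI conjI ballI)
    show "a + b - 2 * \<eta> > 0" using \<eta> by simp
    show "B (0 + (- a + \<eta>)) = p" "B (a + b - 2 * \<eta> + (- a + \<eta>)) = r"
      using \<eta> \<sigma>0 \<tau> by (auto simp: B_def \<sigma>_def)
    show "positive_at (\<lambda>t. B (t + (- a + \<eta>))) t" if "t \<in> {0..a + b - 2 * \<eta>}" for t
      by (rule positive_at_shift, rule B) (use that in auto)
  qed
qed

text \<open>The corner between the end and the beginning of a closed positive curve is rounded, and the
  result is extended periodically. Rounding shortens the parameter interval by \<open>\<eta>\<close> at both ends, which
  gives the period \<open>T - 2 * \<eta>\<close>; it is finally rescaled to 1.\<close>

lemma positively_connected_self_imp_loop:
  assumes "positively_connected p p"
  obtains \<gamma> where "\<And>t. positive_at \<gamma> t" "\<And>t. \<gamma> (t + 1) = \<gamma> t"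
proof -
  obtain T \<tau> where \<tau>: "T > 0" "\<tau> 0 = p" "\<tau> T = p" "\<And>t. t \<in> {0..T} \<Longrightarrow> positive_at \<tau> t"
    using assms(1) unfolding positively_connected_def by blast
  define \<sigma> where "\<sigma> = (\<lambda>t. \<tau> (t + T))"
  \<comment> \<open>With \<open>\<eta> < T / 9\<close> the rounded corner, of half-width \<open>3 * \<eta>\<close>, is disjoint from its
    translate by the period \<open>T - 2 * \<eta>\<close>.\<close>
  have "positive_at \<sigma> 0" "positive_at \<tau> 0" "\<sigma> 0 = \<tau> 0" "T / 9 > 0"
    using \<tau> positive_at_shift[of \<tau> 0 T] by (auto simp: \<sigma>_def)
  then obtain \<eta> \<rho> where \<eta>: "0 < \<eta>" "\<eta> < T / 9"
    and \<rho>: "\<And>t. \<bar>t\<bar> < 3 * \<eta> \<Longrightarrow> positive_at \<rho> t"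
    "\<And>t. - 3 * \<eta> < t \<Longrightarrow> t \<le> - \<eta> \<Longrightarrow> \<rho> t = \<sigma> (t - \<eta>)"
    "\<And>t. \<eta> \<le> t \<Longrightarrow> t < 3 * \<eta> \<Longrightarrow> \<rho> t = \<tau> (t + \<eta>)"
    by (rule positive_corner) blast
  define L where "L = T - 2 * \<eta>"
  have L: "L > 7 * \<eta>" using \<eta> by (simp add: L_def)
  then have "L > 0" using \<eta> by simp
  define B where "B = (\<lambda>t. if t < 2 * \<eta> then \<rho> t else \<tau> (t + \<eta>))"
  define n where "n = (\<lambda>t. \<lfloor>(t + 2 * \<eta>) / L\<rfloor>)"
  define \<gamma> where "\<gamma> = (\<lambda>t. B (t - of_int (n t) * L))"
  have n: "n t = m" if "- 2 * \<eta> \<le> t - of_int m * L" "t - of_int m * L < L - 2 * \<eta>" for t m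
    unfolding n_def using that \<open>L > 0\<close> by (intro floor_unique) (auto simp: field_simps)
  \<comment> \<open>The two ends of the parameter interval overlap in the rounded corner, so that near every
    parameter the periodic extension is a translate either of \<open>\<rho>\<close> or of \<open>\<tau>\<close>.\<close>
  have near: "\<gamma> s = \<rho> (s + - of_int m * L)" if "\<bar>s - of_int m * L\<bar> < 3 * \<eta>" for s m
  proof (cases "s - of_int m * L < - 2 * \<eta>")
    case True
    have ns: "n s = m - 1" using that True L by (intro n) (auto simp: algebra_simps)
    have "s - of_int (n s) * L = s - of_int m * L + L" by (simp add: ns algebra_simps)
    then have "\<gamma> s = B (s - of_int m * L + L)" by (simp only: \<gamma>_def)
    also have "\<dots> = \<tau> (s - of_int m * L + L + \<eta>)"
      using that True L \<eta>(1) by (auto simp: B_def)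
    also have "\<dots> = \<rho> (s + - of_int m * L)"
      using that True \<eta>(1) \<rho>(2)[of "s - of_int m * L"] by (simp add: \<sigma>_def L_def algebra_simps)
    finally show ?thesis .
  next
    case False
    have "n s = m" using that False L by (intro n) auto
    then show ?thesis
      using that \<eta>(1) \<rho>(3)[of "s - of_int m * L"] by (auto simp: \<gamma>_def B_def)
  qed
  have far: "\<gamma> s = \<tau> (s + (\<eta> - of_int m * L))"
    if "\<eta> < s - of_int m * L" "s - of_int m * L < L - \<eta>" for s m
  proof (cases "s - of_int m * L < L - 2 * \<eta>")
    case True
    have "n s = m" using that True \<eta>(1) by (intro n) auto
    then show ?thesis
      using that \<eta>(1) \<rho>(3)[of "s - of_int m * L"] by (auto simp: \<gamma>_def B_def algebra_simps)
  next
    case False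
    have ns: "n s = m + 1" using that False L \<eta>(1) by (intro n) (auto simp: algebra_simps)
    have "s - of_int (n s) * L = s - of_int m * L - L" by (simp add: ns algebra_simps)
    then have "\<gamma> s = B (s - of_int m * L - L)" by (simp only: \<gamma>_def)
    also have "\<dots> = \<rho> (s - of_int m * L - L)"
      using that \<eta>(1) by (simp add: B_def)
    also have "\<dots> = \<tau> (s + (\<eta> - of_int m * L))"
      using that False \<eta>(1) \<rho>(2)[of "s - of_int m * L - L"] by (simp add: \<sigma>_def L_def algebra_simps)
    finally show ?thesis .
  qed
  have pos: "positive_at \<gamma> t" for t
  proof -
    let ?m = "n t" let ?z = "of_int ?m * L"
    have "of_int ?m \<le> (t + 2 * \<eta>) / L" "(t + 2 * \<eta>) / L < of_int ?m + 1"
      unfolding n_def by linarith+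
    then have t: "- 2 * \<eta> \<le> t - ?z" "t - ?z < L - 2 * \<eta>"
      using \<open>L > 0\<close> by (auto simp: field_simps)
    show ?thesis
    proof (cases "t - ?z < 3 * \<eta>")
      case True
      have "positive_at \<rho> (t + - of_int ?m * L)" using True t \<eta>(1) by (intro \<rho>) auto
      then have shifted: "positive_at (\<lambda>s. \<rho> (s + - of_int ?m * L)) t" by (rule positive_at_shift)
      have eq: "\<rho> (s + - of_int ?m * L) = \<gamma> s" if "s \<in> {?z - 3 * \<eta><..<?z + 3 * \<eta>}" for s
        by (rule near[symmetric]) (use that in \<open>simp add: abs_less_iff\<close>)
      show ?thesis
        by (rule positive_at_germ[OF shifted open_greaterThanLessThan _ eq])
          (use True t \<eta>(1) in auto)
    next
      case False
      have "positive_at \<tau> (t + (\<eta> - of_int ?m * L))"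
        using False t \<eta> by (intro \<tau>) (auto simp: L_def)
      then have shifted: "positive_at (\<lambda>s. \<tau> (s + (\<eta> - of_int ?m * L))) t" by (rule positive_at_shift)
      have eq: "\<tau> (s + (\<eta> - of_int ?m * L)) = \<gamma> s" if "s \<in> {?z + \<eta><..<?z + L - \<eta>}" for s
        by (rule far[symmetric]) (use that in auto)
      show ?thesis
        by (rule positive_at_germ[OF shifted open_greaterThanLessThan _ eq])
          (use False t \<eta>(1) in auto)
    qed
  qed
  have per: "\<gamma> (t + L) = \<gamma> t" for t
  proof -
    have "(t + L + 2 * \<eta>) / L = (t + 2 * \<eta>) / L + 1"
      using \<open>L > 0\<close> by (simp add: field_simps)
    then have "n (t + L) = n t + 1" by (simp add: n_def)
    then show ?thesis by (simp add: \<gamma>_def algebra_simps)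
  qed
  show ?thesis
  proof (rule that)
    show "positive_at (\<lambda>s. \<gamma> (L * s + 0)) t" for t
      by (rule positive_at_affine[OF pos \<open>L > 0\<close>])
    show "\<gamma> (L * (t + 1) + 0) = \<gamma> (L * t + 0)" for t
      using per[of "L * t"] by (simp add: algebra_simps)
  qed
qed

text \<open>The starting point is \<open>x - s e\<close> in a chart around \<open>x\<close>, with \<open>e\<close> a positive direction. Seen from
  there, the direction towards \<open>x'\<close> is \<open>e + (x' - x) / s\<close>, which is still positive if \<open>x'\<close> is
  close to \<open>x\<close> compared with \<open>s\<close>.\<close>

lemma positive_segments:
  assumes "q \<in> topspace M" "v \<in> tangent_space A q" "lam q v > 0"
  obtains a V where "openin M V" "q \<in> V" "\<And>q'. q' \<in> V \<Longrightarrow> positively_connected a q'"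
proof -
  obtain c where c: "c \<in> A" "q \<in> fst c"
    using topspace_chart[OF assms(1)] by blast
  define x e where "x = snd c q" and "e = v c"
  have x: "x \<in> snd c ` fst c" using c by (simp add: x_def)
  have "local_form A c lam e x > 0"
    using local_form_chart[OF c, of "v c"] tangent_vector_eq_coord_vec[OF c assms(2)] assms(3)
    by (simp add: x_def e_def)
  then obtain r where r: "r > 0" "ball x r \<subseteq> snd c ` fst c"
    "\<And>y e'. y \<in> ball x r \<Longrightarrow> e' \<in> ball e r \<Longrightarrow> local_form A c lam e' y > 0"
    using local_form_pos_nbhd[OF c(1) x] by blast
  \<comment> \<open>The summand 1 only prevents division by zero.\<close>
  define s where "s = r / (norm e + 1)"
  have s: "s > 0" "s * norm e < r"
  proof -
    have n: "norm e + 1 > 0" using norm_ge_zero[of e] by linarith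
    show "s > 0" using r(1) n by (simp add: s_def)
    have "s * norm e = r * (norm e / (norm e + 1))" by (simp add: s_def)
    also have "\<dots> < r * 1" using r(1) n by (intro mult_strict_left_mono) (simp_all add: field_simps)
    finally show "s * norm e < r" by simp
  qed
  define a where "a = x - s *\<^sub>R e"
  let ?V = "{p \<in> fst c. snd c p \<in> ball x (min r (s * r))}"
  show ?thesis
  proof (rule that)
    show "openin M ?V"
      by (rule openin_chart_preimage[OF chartD[OF c(1)] open_ball])
    show "q \<in> ?V" using c r s by (simp add: x_def)
    fix q' assume q': "q' \<in> ?V"
    define x' d where "x' = snd c q'" and "d = (1 / s) *\<^sub>R (x' - a)"
    have x': "x' \<in> ball x r" "dist x x' < s * r" using q' by (auto simp: x'_def)
    have "d - e = (1 / s) *\<^sub>R (x' - x)"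
      using s(1) by (simp add: d_def a_def algebra_simps)
    then have "norm (d - e) = dist x x' / s"
      using s(1) by (simp add: dist_norm norm_minus_commute)
    also have "\<dots> < r"
      using x'(2) s(1) by (simp add: pos_divide_less_eq mult.commute)
    finally have d: "d \<in> ball e r"
      by (simp add: dist_norm norm_minus_commute)
    have a_ball: "a \<in> ball x r"
      using s by (simp add: a_def dist_norm)
    define f where "f = (\<lambda>t. a + t *\<^sub>R d)"
    define U where "U = f -` ball x r"
    have U: "open U" unfolding U_def f_def by (intro open_vimage continuous_intros) auto
    have fs: "f s = x'" using s(1) by (simp add: f_def d_def)
    have seg: "t \<in> U" if "t \<in> {0..s}" for t
    proof -
      have "f t = (1 - t / s) *\<^sub>R a + (t / s) *\<^sub>R x'"
        using s(1) by (simp add: f_def d_def algebra_simps)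
      moreover have "(1 - t / s) *\<^sub>R a + (t / s) *\<^sub>R x' \<in> ball x r"
        using that s(1) by (intro convexD[OF convex_ball a_ball x'(1)]) auto
      ultimately show ?thesis by (simp add: U_def)
    qed
    show "positively_connected (chart_inv c a) q'"
      unfolding positively_connected_def
    proof (intro exI conjI ballI)
      show "s > 0" by fact
      show "chart_inv c (f 0) = chart_inv c a" by (simp add: f_def)
      show "chart_inv c (f s) = q'"
        using q' chart_inv_chart[OF chartD[OF c(1)]] by (simp add: fs x'_def)
      fix t assume "t \<in> {0..s}"
      then have t: "t \<in> U" by (rule seg)
      show "positive_at (\<lambda>t. chart_inv c (f t)) t"
      proof (rule positive_at_chart_invI[OF c(1) U t])
        show "smooth_on U f" unfolding f_def by (rule smooth_on_affine[OF U])
        show "f ` U \<subseteq> snd c ` fst c" using r(2) by (auto simp: U_def)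
        show "(f has_vector_derivative d) (at t)"
          unfolding f_def by (auto intro!: derivative_eq_intros)
        show "local_form A c lam d (f t) > 0"
          using r(3)[OF _ d] t by (simp add: U_def)
      qed
    qed
  qed
qed

lemma positively_connected_in_topspace: "positively_connected p q \<Longrightarrow> p \<in> topspace M"
  unfolding positively_connected_def positive_at_def
  by (metis atLeastAtMost_iff curve_smooth_at_in_topspace less_eq_real_def)

text \<open>The compactness argument: the starting points belonging to a finite subcover form a finite set
  in which every point has a predecessor.\<close>

theorem exists_positive_loop:
  assumes "compact_space M" "topspace M \<noteq> {}"
    and pos: "\<And>q. q \<in> topspace M \<Longrightarrow> \<exists>v\<in>tangent_space A q. lam q v > 0"
  shows "\<exists>\<gamma>. smooth_loop M A \<gamma> \<and> (\<forall>t. lam (\<gamma> t) (velocity A \<gamma> t) > 0) \<and>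
    (\<forall>t. \<gamma> t \<in> topspace M \<and> velocity A \<gamma> t \<in> tangent_space A (\<gamma> t))"
proof -
  have "\<exists>a V. openin M V \<and> q \<in> V \<and> (\<forall>q'\<in>V. positively_connected a q')" if "q \<in> topspace M" for q
    using pos[OF that] positive_segments[OF that] by metis
  then obtain a V where V: "\<And>q. q \<in> topspace M \<Longrightarrow> openin M (V q)"
    "\<And>q. q \<in> topspace M \<Longrightarrow> q \<in> V q"
    "\<And>q q'. q \<in> topspace M \<Longrightarrow> q' \<in> V q \<Longrightarrow> positively_connected (a q) q'"
    by metis
  have "compactin M (topspace M)"
    using assms(1) by (simp add: compact_space_def)
  then obtain F where F: "finite F" "F \<subseteq> V ` topspace M" "topspace M \<subseteq> \<Union> F"
  proof -
    have "(\<forall>W\<in>V ` topspace M. openin M W) \<and> topspace M \<subseteq> \<Union> (V ` topspace M)"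
      using V(1,2) by blast
    then show ?thesis
      using \<open>compactin M (topspace M)\<close> that unfolding compactin_def by meson
  qed
  obtain Q where Q: "finite Q" "Q \<subseteq> topspace M" "F = V ` Q"
    using finite_subset_image[OF F(1,2)] by blast
  have "\<exists>p. positively_connected p p"
  proof (rule ccontr)
    assume no: "\<not> ?thesis"
    have "a ` Q = {}"
    proof (rule finite_transitivity_chain[where R="\<lambda>x y. positively_connected y x"])
      show "finite (a ` Q)" using Q by simp
      show "\<not> positively_connected x x" for x using no by blast
      show "positively_connected z x" if "positively_connected y x" "positively_connected z y"
        for x y z using positively_connected_trans that by blast
      show "\<exists>y. y \<in> a ` Q \<and> positively_connected y x" if x: "x \<in> a ` Q" for x
      proof -
        have "x \<in> topspace M"
          using x Q V positively_connected_in_topspace by blast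
        then obtain q where "q \<in> Q" "x \<in> V q" using F(3) Q(3) by blast
        then show ?thesis using V(3) Q(2) by blast
      qed
    qed
    then show False using F(3) Q(3) assms(2) by blast
  qed
  then obtain p where "positively_connected p p" ..
  then obtain \<gamma> where \<gamma>: "\<And>t. positive_at \<gamma> t" "\<And>t. \<gamma> (t + 1) = \<gamma> t"
    using positively_connected_self_imp_loop by blast
  have "curve_smooth_at \<gamma> t" for t using \<gamma>(1) by (simp add: positive_at_def)
  then show ?thesis
    using smooth_loopI \<gamma> velocity_in_tangent_space curve_smooth_at_in_topspace
    by (intro exI[of _ \<gamma>]) (simp add: positive_at_def)
qed

section \<open>Locally conformally symplectic forms\<close>

lemma local_form_derivative_lincomb:
  assumes "c \<in> A" "x \<in> snd c ` fst c"
  shows "frechet_derivative (local_form A c lam (a *\<^sub>R e + b *\<^sub>R e')) (at x) h =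
    a * frechet_derivative (local_form A c lam e) (at x) h +
    b * frechet_derivative (local_form A c lam e') (at x) h"
proof -
  have d: "(local_form A c lam e has_derivative frechet_derivative (local_form A c lam e) (at x)) (at x)"
    for e
    using smooth_on_imp_differentiable[OF smooth_local_form[OF assms(1)] assms(2)]
      frechet_derivative_works by blast
  have "((\<lambda>y. a * local_form A c lam e y + b * local_form A c lam e' y) has_derivative
    (\<lambda>h. a * frechet_derivative (local_form A c lam e) (at x) h +
      b * frechet_derivative (local_form A c lam e') (at x) h)) (at x)"
    by (intro has_derivative_add has_derivative_mult_right d)
  then have "(local_form A c lam (a *\<^sub>R e + b *\<^sub>R e') has_derivative
    (\<lambda>h. a * frechet_derivative (local_form A c lam e) (at x) h +
      b * frechet_derivative (local_form A c lam e') (at x) h)) (at x)"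
  proof (rule has_derivative_transform_within_open[where s="snd c ` fst c"])
    show "open (snd c ` fst c)" using chartD[OF assms(1)] by (simp add: is_chart_def)
    show "x \<in> snd c ` fst c" by fact
    show "a * local_form A c lam e y + b * local_form A c lam e' y =
        local_form A c lam (a *\<^sub>R e + b *\<^sub>R e') y" if "y \<in> snd c ` fst c" for y
      by (rule local_form_lincomb[OF assms(1) that, symmetric])
  qed
  then show ?thesis
    by (simp add: frechet_derivative_at[symmetric])
qed

text \<open>The exterior derivative is computed in one chart chosen for each point, so bilinearity can be
  checked in that chart alone.\<close>

lemma ext_deriv_lincomb_left:
  assumes "p \<in> topspace M"
  shows "ext_deriv A lam p (\<lambda>c. a *\<^sub>R u c + b *\<^sub>R u' c) w =
    a * ext_deriv A lam p u w + b * ext_deriv A lam p u' w"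
proof -
  define c where "c = (SOME c. c \<in> A \<and> p \<in> fst c)"
  have "\<exists>c. c \<in> A \<and> p \<in> fst c" using topspace_chart[OF assms] by blast
  then have "c \<in> A \<and> p \<in> fst c" unfolding c_def by (rule someI_ex)
  then have c: "c \<in> A" "p \<in> fst c" by auto
  then have x: "snd c p \<in> snd c ` fst c" by simp
  have "linear (frechet_derivative (local_form A c lam (w c)) (at (snd c p)))"
    using smooth_on_imp_differentiable[OF smooth_local_form[OF c(1)] x]
    by (rule linear_frechet_derivative)
  then show ?thesis
    unfolding ext_deriv_def c_def[symmetric] Let_def local_form_derivative_lincomb[OF c(1) x]
    by (simp add: linear_add linear_cmul algebra_simps)
qed

end

lemma ext_deriv_swap: "ext_deriv A \<beta> p v u = - ext_deriv A \<beta> p u v"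
  by (simp add: ext_deriv_def Let_def)

lemma lcs_form_swap: "lcs_form A \<beta> \<eta> p v u = - lcs_form A \<beta> \<eta> p u v"
  by (simp add: lcs_form_def wedge_def ext_deriv_swap[of A \<beta> p v u])

locale lcs_mfd = one_form_mfd M A lam
  for M :: "'a topology" and A :: "('a, 'e::euclidean_space) chart set" and lam +
  fixes \<alpha> :: "('a, 'e) form1"
  assumes form_alpha: "one_form M A \<alpha>"
    and nondeg: "nondegenerate M A (lcs_form A lam \<alpha>)"
begin

lemma one_form_mfdI: "one_form M A \<beta> \<Longrightarrow> one_form_mfd M A \<beta>"
  by unfold_locales

lemma lcs_form_lincomb_left:
  assumes "p \<in> topspace M" "u \<in> tangent_space A p" "u' \<in> tangent_space A p"
  shows "lcs_form A lam \<alpha> p (\<lambda>c. a *\<^sub>R u c + b *\<^sub>R u' c) w =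
    a * lcs_form A lam \<alpha> p u w + b * lcs_form A lam \<alpha> p u' w"
  unfolding lcs_form_def wedge_def ext_deriv_lincomb_left[OF assms(1)] form_lincomb[OF assms]
    one_form_mfd.form_lincomb[OF one_form_mfdI[OF form_alpha] assms]
  by (simp add: algebra_simps)

lemma lcs_form_lincomb_right:
  assumes "p \<in> topspace M" "u \<in> tangent_space A p" "u' \<in> tangent_space A p"
  shows "lcs_form A lam \<alpha> p w (\<lambda>c. a *\<^sub>R u c + b *\<^sub>R u' c) =
    a * lcs_form A lam \<alpha> p w u + b * lcs_form A lam \<alpha> p w u'"
  unfolding lcs_form_swap[of A lam \<alpha> p w] lcs_form_lincomb_left[OF assms] by simp

text \<open>In a chart, sending a vector \<open>e\<close> to the vector that represents the functional
  \<open>\<omega> e\<close> with respect to the inner product is an injective, hence surjective, linear map.\<close>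

lemma dual_field_exists:
  assumes \<beta>: "one_form M A \<beta>" and p: "p \<in> topspace M"
  shows "\<exists>u\<in>tangent_space A p. \<forall>v\<in>tangent_space A p. lcs_form A lam \<alpha> p u v = \<beta> p v"
proof -
  interpret \<beta>: one_form_mfd M A \<beta> by (rule one_form_mfdI[OF \<beta>])
  obtain c where c: "c \<in> A" "p \<in> fst c" using topspace_chart[OF p] by blast
  define w where "w = (\<lambda>e e'. lcs_form A lam \<alpha> p (coord_vec A c e p) (coord_vec A c e' p))"
  note T = coord_vec_in_tangent_space[OF c]
  have wl: "w (a *\<^sub>R e + b *\<^sub>R e') h = a * w e h + b * w e' h" for a b e e' h
    unfolding w_def coord_vec_lincomb[OF c] by (rule lcs_form_lincomb_left[OF p T T])
  have wr: "w h (a *\<^sub>R e + b *\<^sub>R e') = a * w h e + b * w h e'" for a b e e' h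
    unfolding w_def coord_vec_lincomb[OF c] by (rule lcs_form_lincomb_right[OF p T T])
  have lw: "linear (w h)" for h
    using wr[of h 1 _ 1] wr[of h _ _ 0] by (intro linearI) auto
  have l\<beta>: "linear (\<lambda>e. \<beta> p (coord_vec A c e p))"
    using \<beta>.linear_local_form[OF c(1), of "snd c p"] c by (simp add: \<beta>.local_form_chart)
  define f where "f = (\<lambda>e. \<Sum>b\<in>Basis. w e b *\<^sub>R b)"
  have fb: "f e \<bullet> b = w e b" if "b \<in> Basis" for e b
    unfolding f_def by (rule inner_sum_left_Basis[OF that])
  have "linear f"
    using wl[of 1 _ 1] wl[of _ _ 0]
    by (intro linearI) (auto simp: f_def scaleR_add_left sum.distrib scaleR_sum_right)
  moreover have "inj f"
    unfolding linear_inj_iff_eq_0[OF \<open>linear f\<close>]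
  proof (intro allI impI)
    fix e assume "f e = 0"
    then have "w e b = 0" if "b \<in> Basis" for b using fb[OF that, of e] by simp
    then have we: "w e e' = 0" for e'
      using linear_euclidean_expansion[OF lw, of e e'] by simp
    have "lcs_form A lam \<alpha> p (coord_vec A c e p) v = 0" if "v \<in> tangent_space A p" for v
      using we[of "v c"] tangent_vector_eq_coord_vec[OF c that] by (simp add: w_def)
    then have "coord_vec A c e p = (\<lambda>_. 0)"
      using nondeg p T unfolding nondegenerate_def by blast
    then show "e = 0" using coord_vec_chart[OF c, of e] by simp
  qed
  ultimately obtain e where e: "f e = (\<Sum>b\<in>Basis. \<beta> p (coord_vec A c b p) *\<^sub>R b)"
    using linear_injective_imp_surjective by (metis surjD)
  have "w e b = \<beta> p (coord_vec A c b p)" if "b \<in> Basis" for b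
    using fb[OF that, of e] inner_sum_left_Basis[OF that] by (simp add: e)
  then have w\<beta>: "w e e' = \<beta> p (coord_vec A c e' p)" for e'
    using linear_euclidean_expansion[OF lw, of e e'] linear_euclidean_expansion[OF l\<beta>, of e'] by simp
  have "lcs_form A lam \<alpha> p (coord_vec A c e p) v = \<beta> p v" if "v \<in> tangent_space A p" for v
    using w\<beta>[of "v c"] tangent_vector_eq_coord_vec[OF c that] by (simp add: w_def)
  then show ?thesis using T by blast
qed

lemma dual_field:
  assumes \<beta>: "one_form M A \<beta>" and p: "p \<in> topspace M"
  shows "dual_field A (lcs_form A lam \<alpha>) \<beta> p \<in> tangent_space A p"
    and "v \<in> tangent_space A p \<Longrightarrow>
      lcs_form A lam \<alpha> p (dual_field A (lcs_form A lam \<alpha>) \<beta> p) v = \<beta> p v"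
proof -
  let ?P = "\<lambda>u. u \<in> tangent_space A p \<and> (\<forall>v\<in>tangent_space A p. lcs_form A lam \<alpha> p u v = \<beta> p v)"
  have "u = u'" if u: "?P u" "?P u'" for u u'
  proof -
    have "lcs_form A lam \<alpha> p (\<lambda>c. 1 *\<^sub>R u c + (- 1) *\<^sub>R u' c) v = 0" if "v \<in> tangent_space A p" for v
      using u that lcs_form_lincomb_left[OF p, of u u' 1 "-1" v] by simp
    moreover have "(\<lambda>c. 1 *\<^sub>R u c + (- 1) *\<^sub>R u' c) \<in> tangent_space A p"
      using tangent_space_lincomb[OF p] u by blast
    ultimately have "(\<lambda>c. 1 *\<^sub>R u c + (- 1) *\<^sub>R u' c) = (\<lambda>c. 0)"
      using nondeg p unfolding nondegenerate_def by blast
    then show ?thesis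
      by (auto simp: fun_eq_iff)
  qed
  then have "\<exists>!u. ?P u" using dual_field_exists[OF assms] by blast
  then have "?P (dual_field A (lcs_form A lam \<alpha>) \<beta> p)"
    unfolding dual_field_def by (rule theI')
  then show "dual_field A (lcs_form A lam \<alpha>) \<beta> p \<in> tangent_space A p"
    and "v \<in> tangent_space A p \<Longrightarrow>
      lcs_form A lam \<alpha> p (dual_field A (lcs_form A lam \<alpha>) \<beta> p) v = \<beta> p v"
    by auto
qed

text \<open>Here \<open>\<lambda>(X\<^sub>\<lambda>) = \<omega>(X\<^sub>\<lambda>, X\<^sub>\<lambda>) = 0\<close>, whereas \<open>\<lambda>(X\<^sub>\<alpha>) = \<omega>(X\<^sub>\<lambda>, X\<^sub>\<alpha>) > 0\<close>. So the two vectors are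
  linearly independent, and on a surface they span the tangent plane.\<close>

lemma lcs_distribution_surface:
  assumes dim: "DIM('e) = 2" and p: "p \<in> topspace M" and pos: "lam p (X_alpha A lam \<alpha> p) > 0"
    and v: "v \<in> tangent_space A p"
  shows "v \<in> lcs_distribution A lam \<alpha> p"
proof -
  define X Y where "X = X_alpha A lam \<alpha> p" and "Y = X_lambda A lam \<alpha> p"
  have X: "X \<in> tangent_space A p"
    unfolding X_def X_alpha_def by (rule dual_field(1)[OF form_alpha p])
  have Y: "Y \<in> tangent_space A p" "\<And>v. v \<in> tangent_space A p \<Longrightarrow> lcs_form A lam \<alpha> p Y v = lam p v"
    unfolding Y_def X_lambda_def by (rule dual_field[OF form p], assumption?)+
  have Y0: "lam p Y = 0"
    using Y(2)[OF Y(1)] lcs_form_swap[of A lam \<alpha> p Y Y] by simp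
  obtain c where c: "c \<in> A" "p \<in> fst c" using topspace_chart[OF p] by blast
  have form_c: "lam p v = local_form A c lam (v c) (snd c p)" if "v \<in> tangent_space A p" for v
    using tangent_vector_eq_coord_vec[OF c that] local_form_chart[OF c] by simp
  have lin: "linear (\<lambda>e. local_form A c lam e (snd c p))"
    by (rule linear_local_form) (use c in auto)
  have "Y c \<noteq> 0"
  proof
    assume "Y c = 0"
    then have "Y = (\<lambda>d. 0 *\<^sub>R Y d + 0 *\<^sub>R Y d)"
      using tangent_vector_eq_coord_vec[OF c Y(1)] coord_vec_lincomb[OF c, of 0 "Y c" 0 "Y c"]
      by (metis (no_types, lifting) add.right_neutral scaleR_zero_left scaleR_zero_right)
    then have "lcs_form A lam \<alpha> p Y X = 0"
      using lcs_form_lincomb_left[OF p Y(1) Y(1), of 0 0 X] by simp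
    then show False using Y(2)[OF X] pos by (simp add: X_def)
  qed
  moreover have "X c \<notin> span {Y c}"
  proof
    assume "X c \<in> span {Y c}"
    then obtain k where "X c = k *\<^sub>R Y c" by (auto simp: span_singleton)
    then have "lam p X = k * lam p Y"
      using form_c[OF X] form_c[OF Y(1)] linear_cmul[OF lin] by simp
    then show False using Y0 pos by (simp add: X_def)
  qed
  ultimately have ind: "independent {X c, Y c}" "X c \<noteq> Y c"
    by (auto simp: independent_insert span_base)
  then have "dim {X c, Y c} = DIM('e)"
    using dim by (simp add: dim_eq_card_independent)
  then have "v c \<in> span {X c, Y c}"
    by (simp add: dim_eq_full)
  then obtain a b where "v c = a *\<^sub>R X c + b *\<^sub>R Y c"
    by (auto simp: span_insert span_singleton algebra_simps)
  then have "v = (\<lambda>d. a *\<^sub>R X d + b *\<^sub>R Y d)"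
    using tangent_vector_eq_coord_vec[OF c v] coord_vec_lincomb[OF c, of a "X c" b "Y c"]
      tangent_vector_eq_coord_vec[OF c X] tangent_vector_eq_coord_vec[OF c Y(1)] by simp
  then show ?thesis
    unfolding lcs_distribution_def X_def Y_def by blast
qed

end

theorem corollary3p8:
  fixes M :: "'a topology"
    and A :: "('a, real ^ 2) chart set"
    and lam \<alpha> :: "('a, real ^ 2) form1"
  assumes "exact_lcs_manifold M A lam \<alpha>"
    and "compact_space M" and "topspace M \<noteq> {}"
    and "reeb_condition M A lam \<alpha>"
  shows "\<exists>\<gamma>. reeb_1_curve M A lam \<alpha> \<gamma>"
proof -
  interpret lcs_mfd M A lam \<alpha>
    using assms(1) by unfold_locales (auto simp: exact_lcs_manifold_def)
  have reeb: "lam p (X_alpha A lam \<alpha> p) > 0" if "p \<in> topspace M" for p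
    using assms(4) that by (simp add: reeb_condition_def)
  have "\<exists>v\<in>tangent_space A p. lam p v > 0" if "p \<in> topspace M" for p
    using reeb[OF that] dual_field(1)[OF form_alpha that] unfolding X_alpha_def by blast
  then obtain \<gamma> where "smooth_loop M A \<gamma>" "\<And>t. lam (\<gamma> t) (velocity A \<gamma> t) > 0"
    "\<And>t. \<gamma> t \<in> topspace M" "\<And>t. velocity A \<gamma> t \<in> tangent_space A (\<gamma> t)"
    using exists_positive_loop[OF assms(2,3)] by blast
  then have "reeb_1_curve M A lam \<alpha> \<gamma>"
    unfolding reeb_1_curve_def by (simp add: lcs_distribution_surface reeb)
  then show ?thesis by blast
qed

end
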